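(* Suppose that $\beta=0$ and $p=1/2$, and let $\xi$ be started from an arbitrary fixed configuration $\xi_0=S_0\in\mathcal{D}$. For any $\varepsilon>0$, $\mathbb{P}_{0,1/2}$-a.s., for all but finitely many $t\in\mathbb{Z}^+$, $$t^{1/3}(\log t)^{-(1/3)-\varepsilon}\le\max_{0\le s\le t}|\xi_s|\le t^{1/2}(\log t)^{(1/2)+\varepsilon}.$$
   Context: Configurations: let $\mathcal{D}'\subset\{0,1\}^{\mathbb{Z}}$ be the set of configurations with finitely many $0$'s to the left of the origin and finitely many $1$'s to the right. Call $S,S'\in\mathcal{D}'$ equivalent if they are translates of each other, and let $\mathcal{D}$ be the (countable) set of equivalence classes. So each $S\in\mathcal{D}$ is an infinite string of $1$'s, followed by a finite string of $0$'s and $1$'s, followed by an infinite string of $0$'s, modulo translation. The ground state is $\mathcal{D}_0=\ldots 111000\ldots$ (up to translation). An unlike pair is a pair of adjacent sites with labels $01$ or $10$ (read left to right); each configuration has finitely many of them and at least one. Process: for $\beta,p\in[0,1]$ the discrete-time exclusion-voter process $\xi=(\xi_t)_{t\in\mathbb{Z}^+}$, $\mathbb{Z}^+=\{0,1,2,\ldots\}$, is the time-homogeneous Markov chain on $\mathcal{D}$ with the following one-step dynamics. At each time step, independently, a voter move is chosen with probability $\beta$ and an exclusion move with probability $1-\beta$; then one of the unlike pairs of the current configuration is chosen uniformly at random. In a voter move the chosen pair is replaced by $00$ or by $11$, each with probability $1/2$. In an exclusion move, a chosen pair $01$ becomes $10$ with probability $p$ (otherwise no change), and a chosen pair $10$ becomes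 $01$ with probability $1-p$ (otherwise no change). Its law is denoted $\mathbb{P}_{\beta,p}$. (For $\beta=0$ only exclusion moves occur.) Size of the hybrid zone: for $S\in\mathcal{D}\setminus\{\mathcal{D}_0\}$, $|S|$ is the length of the finite string of $S$ lying between the infinite (maximal) block of $1$'s on the left and the infinite (maximal) block of $0$'s on the right; $|\mathcal{D}_0|=0$. *)

theory Defs
  imports "HOL-Probability.Probability"
begin

section \<open>Configurations modulo translation\<close>

type_synonym config = "int \<Rightarrow> bool"  \<comment> \<open>\<open>True\<close> is the label 1, \<open>False\<close> the label 0\<close>

definition zone_configs :: "config set" where
  "zone_configs = {S. finite {x. x < 0 \<and> \<not> S x} \<and> finite {x. x > 0 \<and> S x}}"

definition translate :: "int \<Rightarrow> config \<Rightarrow> config" where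
  "translate k S = (\<lambda>x. S (x + k))"

definition translates :: "config \<Rightarrow> config \<Rightarrow> bool" where
  "translates S T \<longleftrightarrow> S \<in> zone_configs \<and> T \<in> zone_configs \<and> (\<exists>k. T = translate k S)"

definition ground_config :: config where
  "ground_config = (\<lambda>x. x < 0)"

lemma ground_config_in_zone_configs: "ground_config \<in> zone_configs"
proof -
  have "{x::int. x < 0 \<and> \<not> x < 0} = {}" "{x::int. x > 0 \<and> x < 0} = {}"
    by auto
  then show ?thesis
    by (simp add: zone_configs_def ground_config_def)
qed

lemma part_equivp_translates: "part_equivp translates"
proof (rule part_equivpI)
  have "ground_config = translate 0 ground_config"
    by (simp add: translate_def)
  then show "\<exists>S. translates S S"
    using ground_config_in_zone_configs unfolding translates_def by blast
  have "S = translate (- k) (translate k S)" for S k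
    by (simp add: translate_def)
  then show "symp translates"
    unfolding symp_def translates_def by metis
  have "translate j (translate k S) = translate (j + k) S" for S j k
    by (simp add: translate_def add.assoc)
  then show "transp translates"
    unfolding transp_def translates_def by metis
qed

quotient_type zone = config / partial: translates
  by (rule part_equivp_translates)


section \<open>Size of the hybrid zone\<close>

definition leftmost_zero :: "config \<Rightarrow> int" where
  "leftmost_zero S = Inf {x. \<not> S x}"

definition rightmost_one :: "config \<Rightarrow> int" where
  "rightmost_one S = Sup {x. S x}"

text \<open>
  The string between the two infinite blocks occupies the sites from the leftmost 0 to the
  rightmost 1.  For the ground state the rightmost 1 is immediately to the left of the
  leftmost 0, so the same formula gives 0 (lemma \<open>zone_size_ground\<close>).
\<close>

definition config_size :: "config \<Rightarrow> nat" where
  "config_size S = nat (rightmost_one S - leftmost_zero S + 1)"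

lemma zone_configs_bounds:
  assumes "S \<in> zone_configs"
  obtains a b where "a < b" "\<And>x. x \<le> a \<Longrightarrow> S x" "\<And>x. x \<ge> b \<Longrightarrow> \<not> S x"
proof -
  have fa: "finite (insert 0 {x. x < 0 \<and> \<not> S x})" and fb: "finite (insert 0 {x. x > 0 \<and> S x})"
    using assms by (auto simp: zone_configs_def)
  define a where "a = Min (insert 0 {x. x < 0 \<and> \<not> S x}) - 1"
  define b where "b = Max (insert 0 {x. x > 0 \<and> S x}) + 1"
  have a: "a < y" if "y \<in> insert 0 {x. x < 0 \<and> \<not> S x}" for y
    using Min_le[OF fa that] by (simp add: a_def)
  have b: "b > y" if "y \<in> insert 0 {x. x > 0 \<and> S x}" for y
    using Max_ge[OF fb that] by (simp add: b_def)
  show ?thesis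
  proof (rule that[of a b])
    show "a < b" using a[of 0] b[of 0] by simp
    show "S x" if "x \<le> a" for x
      using a[of x] a[of 0] that by force
    show "\<not> S x" if "x \<ge> b" for x
      using b[of x] b[of 0] that by force
  qed
qed

lemma leftmost_zero_translate:
  assumes "S \<in> zone_configs"
  shows "leftmost_zero (translate k S) = leftmost_zero S - k"
proof -
  obtain a b where ab: "\<And>x. x \<le> a \<Longrightarrow> S x" "\<And>x. x \<ge> b \<Longrightarrow> \<not> S x"
    using zone_configs_bounds[OF assms] by metis
  have bdd: "bdd_below {x. \<not> S x}" and ne: "{x. \<not> S x} \<noteq> {}"
    using ab by (auto intro!: bdd_belowI[of _ a]) (meson linorder_linear)
  have im: "{x. \<not> translate k S x} = (\<lambda>x. x - k) ` {x. \<not> S x}"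
    by (force simp: translate_def image_iff)
  show ?thesis
    unfolding leftmost_zero_def
  proof (rule cInf_eq_non_empty)
    show "{x. \<not> translate k S x} \<noteq> {}" using ne im by auto
    show "Inf {x. \<not> S x} - k \<le> x" if "x \<in> {x. \<not> translate k S x}" for x
      using that cInf_lower[OF _ bdd] unfolding im by auto
    show "y \<le> Inf {x. \<not> S x} - k" if "\<And>x. x \<in> {x. \<not> translate k S x} \<Longrightarrow> y \<le> x" for y
    proof -
      have "y + k \<le> Inf {x. \<not> S x}"
      proof (rule cInf_greatest[OF ne])
        fix z assume "z \<in> {x. \<not> S x}"
        then show "y + k \<le> z"
          using that[of "z - k"] unfolding im by simp
      qed
      then show ?thesis by simp
    qed
  qed
qed

lemma rightmost_one_translate:
  assumes "S \<in> zone_configs"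
  shows "rightmost_one (translate k S) = rightmost_one S - k"
proof -
  obtain a b where ab: "\<And>x. x \<le> a \<Longrightarrow> S x" "\<And>x. x \<ge> b \<Longrightarrow> \<not> S x"
    using zone_configs_bounds[OF assms] by metis
  have bdd: "bdd_above {x. S x}" and ne: "{x. S x} \<noteq> {}"
    using ab by (auto intro!: bdd_aboveI[of _ b]) (meson linorder_linear)
  have im: "{x. translate k S x} = (\<lambda>x. x - k) ` {x. S x}"
    by (force simp: translate_def image_iff)
  show ?thesis
    unfolding rightmost_one_def
  proof (rule cSup_eq_non_empty)
    show "{x. translate k S x} \<noteq> {}" using ne im by auto
    show "x \<le> Sup {x. S x} - k" if "x \<in> {x. translate k S x}" for x
      using that cSup_upper[OF _ bdd] unfolding im by auto
    show "Sup {x. S x} - k \<le> y" if "\<And>x. x \<in> {x. translate k S x} \<Longrightarrow> x \<le> y" for y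
    proof -
      have "Sup {x. S x} \<le> y + k"
      proof (rule cSup_least[OF ne])
        fix z assume "z \<in> {x. S x}"
        then show "z \<le> y + k"
          using that[of "z - k"] unfolding im by simp
      qed
      then show ?thesis by simp
    qed
  qed
qed

lift_definition zone_size :: "zone \<Rightarrow> nat" is config_size
  by (auto simp: translates_def config_size_def leftmost_zero_translate rightmost_one_translate)

lift_definition ground :: zone is ground_config
  using ground_config_in_zone_configs
  by (auto simp: translates_def translate_def intro!: exI[of _ 0])

lemma zone_size_ground: "zone_size ground = 0"
proof transfer
  have "Inf {x::int. \<not> x < 0} = 0"
    by (rule cInf_eq_minimum) auto
  moreover have "Sup {x::int. x < 0} = -1"
    by (rule cSup_eq_maximum) auto
  ultimately show "config_size ground_config = 0"
    by (simp add: config_size_def leftmost_zero_def rightmost_one_def ground_config_def)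
qed


section \<open>One-step dynamics\<close>

text \<open>An unlike pair is identified with its left site.\<close>

definition unlike_pairs :: "config \<Rightarrow> int set" where
  "unlike_pairs S = {x. S x \<noteq> S (x + 1)}"

definition voter_move :: "config \<Rightarrow> int \<Rightarrow> config pmf" where
  "voter_move S x = map_pmf (\<lambda>b. S(x := b, x + 1 := b)) (bernoulli_pmf (1 / 2))"

definition exclusion_move :: "real \<Rightarrow> config \<Rightarrow> int \<Rightarrow> config pmf" where
  "exclusion_move p S x =
     (if \<not> S x \<and> S (x + 1)
      then map_pmf (\<lambda>b. if b then S(x := True, x + 1 := False) else S) (bernoulli_pmf p)
      else map_pmf (\<lambda>b. if b then S(x := False, x + 1 := True) else S) (bernoulli_pmf (1 - p)))"

definition config_step :: "real \<Rightarrow> real \<Rightarrow> config \<Rightarrow> config pmf" where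
  "config_step \<beta> p S =
     do {
       v \<leftarrow> bernoulli_pmf \<beta>;
       x \<leftarrow> pmf_of_set (unlike_pairs S);
       if v then voter_move S x else exclusion_move p S x
     }"

lemma finite_unlike_pairs:
  assumes "S \<in> zone_configs"
  shows "finite (unlike_pairs S)"
proof -
  obtain a b where ab: "\<And>x. x \<le> a \<Longrightarrow> S x" "\<And>x. x \<ge> b \<Longrightarrow> \<not> S x"
    using zone_configs_bounds[OF assms] by metis
  have "x \<in> {a - 1..b}" if "S x \<noteq> S (x + 1)" for x
    using that ab[of x] ab[of "x + 1"] by force
  then have "unlike_pairs S \<subseteq> {a - 1..b}"
    by (auto simp: unlike_pairs_def)
  then show ?thesis
    using finite_subset by blast
qed

lemma unlike_pairs_nonempty:
  assumes "S \<in> zone_configs"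
  shows "unlike_pairs S \<noteq> {}"
proof
  assume "unlike_pairs S = {}"
  then have eq: "S (x + 1) = S x" for x
    by (auto simp: unlike_pairs_def)
  obtain a b where ab: "a < b" "\<And>x. x \<le> a \<Longrightarrow> S x" "\<And>x. x \<ge> b \<Longrightarrow> \<not> S x"
    using zone_configs_bounds[OF assms] by metis
  have "S (a + int n) = S a" for n
  proof (induction n)
    case (Suc n)
    have "a + int (Suc n) = (a + int n) + 1" by simp
    then show ?case using eq[of "a + int n"] Suc by metis
  qed simp
  from this[of "nat (b - a)"] ab show False
    by simp
qed

lemma fun_upd_in_zone_configs:
  assumes "S \<in> zone_configs"
  shows "S(x := b) \<in> zone_configs"
proof -
  have "{y. y < 0 \<and> \<not> (S(x := b)) y} \<subseteq> insert x {y. y < 0 \<and> \<not> S y}"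
    "{y. y > 0 \<and> (S(x := b)) y} \<subseteq> insert x {y. y > 0 \<and> S y}"
    by auto
  moreover have "finite (insert x {y. y < 0 \<and> \<not> S y})" "finite (insert x {y. y > 0 \<and> S y})"
    using assms by (simp_all add: zone_configs_def)
  ultimately show ?thesis
    unfolding zone_configs_def mem_Collect_eq by (meson finite_subset)
qed

lemma set_config_step:
  assumes "S \<in> zone_configs"
  shows "set_pmf (config_step \<beta> p S) \<subseteq> zone_configs"
  using assms
  by (auto simp: config_step_def voter_move_def exclusion_move_def fun_upd_in_zone_configs
           split: if_splits)

lemma config_step_translate:
  assumes "S \<in> zone_configs"
  shows "config_step \<beta> p (translate k S) = map_pmf (translate k) (config_step \<beta> p S)"
proof -
  have upd: "(translate k S)(x - k := a, x - k + 1 := b) = translate k (S(x := a, x + 1 := b))" for x a b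
    by (auto simp: translate_def fun_eq_iff)
  have "unlike_pairs (translate k S) = (\<lambda>x. x - k) ` unlike_pairs S"
    by (force simp: unlike_pairs_def translate_def image_iff algebra_simps)
  then have pairs: "pmf_of_set (unlike_pairs (translate k S)) =
      map_pmf (\<lambda>x. x - k) (pmf_of_set (unlike_pairs S))"
    using finite_unlike_pairs[OF assms] unlike_pairs_nonempty[OF assms]
    by (simp add: map_pmf_of_set_inj inj_on_def)
  have voter: "voter_move (translate k S) (x - k) = map_pmf (translate k) (voter_move S x)" for x
    unfolding voter_move_def upd by (simp add: pmf.map_comp o_def)
  have at: "translate k S (x - k) = S x" "translate k S (x - k + 1) = S (x + 1)" for x
    by (auto simp: translate_def algebra_simps)
  have excl: "exclusion_move p (translate k S) (x - k) = map_pmf (translate k) (exclusion_move p S x)" for x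
    unfolding exclusion_move_def upd at
    by (auto simp: pmf.map_comp o_def intro!: map_pmf_cong)
  show ?thesis
    unfolding config_step_def pairs
    by (auto simp: map_bind_pmf bind_map_pmf voter excl intro!: bind_pmf_cong)
qed

lift_definition zone_step :: "real \<Rightarrow> real \<Rightarrow> zone \<Rightarrow> zone pmf"
  is "\<lambda>\<beta> p S. map_pmf abs_zone (config_step \<beta> p S)"
proof -
  fix \<beta> p and S T :: config
  assume "translates S T"
  then obtain k where S: "S \<in> zone_configs" and T: "T = translate k S"
    by (auto simp: translates_def)
  have translate_in: "translate k U \<in> zone_configs" if U: "U \<in> zone_configs" for U
  proof -
    obtain a b where ab: "\<And>x. x \<le> a \<Longrightarrow> U x" "\<And>x. x \<ge> b \<Longrightarrow> \<not> U x"
      using zone_configs_bounds[OF U] by metis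
    have "x \<in> {a - k..0}" if "x < 0" "\<not> U (x + k)" for x
      using ab(1)[of "x + k"] that by force
    then have "{x. x < 0 \<and> \<not> U (x + k)} \<subseteq> {a - k..0}" by blast
    moreover have "x \<in> {0..b - k}" if "x > 0" "U (x + k)" for x
      using ab(2)[of "x + k"] that by force
    then have "{x. x > 0 \<and> U (x + k)} \<subseteq> {0..b - k}" by blast
    ultimately show ?thesis
      unfolding zone_configs_def translate_def mem_Collect_eq
      by (meson finite_subset finite_atLeastAtMost_int)
  qed
  have "abs_zone (translate k U) = abs_zone U" if "U \<in> set_pmf (config_step \<beta> p S)" for U
  proof -
    have "U \<in> zone_configs"
      using set_config_step[OF S] that by blast
    then have "translates U (translate k U)"
      using translate_in by (auto simp: translates_def)
    then show ?thesis
      using Quotient_rel_abs[OF Quotient_zone] by metis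
  qed
  then have "map_pmf (\<lambda>U. abs_zone (translate k U)) (config_step \<beta> p S) =
      map_pmf abs_zone (config_step \<beta> p S)"
    by (intro map_pmf_cong) auto
  then show "map_pmf abs_zone (config_step \<beta> p S) = map_pmf abs_zone (config_step \<beta> p T)"
    unfolding T config_step_translate[OF S] by (simp add: pmf.map_comp o_def)
qed


section \<open>The exclusion-voter process\<close>

text \<open>
  Time-homogeneous Markov chain with transition kernel \<open>K\<close> and initial state \<open>s\<close>.  The last
  condition is the Markov property with the conditional probability multiplied out, so that
  paths of probability 0 need no separate treatment.
\<close>

definition markov_chain ::
  "'w measure \<Rightarrow> ('s \<Rightarrow> 's pmf) \<Rightarrow> 's \<Rightarrow> (nat \<Rightarrow> 'w \<Rightarrow> 's) \<Rightarrow> bool" where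
  "markov_chain M K s X \<longleftrightarrow>
     prob_space M \<and>
     (\<forall>n. X n \<in> measurable M (count_space UNIV)) \<and>
     (AE \<omega> in M. X 0 \<omega> = s) \<and>
     (\<forall>n x. measure M {\<omega> \<in> space M. \<forall>i\<le>Suc n. X i \<omega> = x i} =
        measure M {\<omega> \<in> space M. \<forall>i\<le>n. X i \<omega> = x i} * pmf (K (x n)) (x (Suc n)))"

definition exclusion_voter_process ::
  "real \<Rightarrow> real \<Rightarrow> 'w measure \<Rightarrow> zone \<Rightarrow> (nat \<Rightarrow> 'w \<Rightarrow> zone) \<Rightarrow> bool" where
  "exclusion_voter_process \<beta> p M S\<^sub>0 \<xi> \<longleftrightarrow> markov_chain M (zone_step \<beta> p) S\<^sub>0 \<xi>"

end

theory Submission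
  imports Defs "HOL-Real_Asymp.Real_Asymp"
begin

text \<open>
  In a symmetric exclusion move with \<open>N\<close> unlike pairs, each of them is exchanged with probability
  \<open>1 / (2 * N)\<close>.  Each bound comes from a function of the configuration whose drift under such
  a move can be computed exactly.

  Lower bound: the number \<open>I\<close> of inversions (a 0 somewhere to the left of a 1) goes up by 1 when a
  pair 10 is exchanged and down by 1 for a pair 01.  There is always one more pair 10 than 01, so
  \<open>I\<close> has drift \<open>1 / (2 * N)\<close> (lemma \<open>zone_inversions_drift\<close>).  If the size of the zone is at most
  \<open>r\<close>, then \<open>N \<le> r + 1\<close> and \<open>I \<le> r\<^sup>2\<close>; so the zone outgrows \<open>r\<close> in a mean time of
  order at most \<open>r\<^sup>2 * r\<close>, and stays small up to time \<open>n\<close> with probability of order at most \<open>r ^ 3 / n\<close>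
  (lemma \<open>small_zone_prob\<close>).  With \<open>n = 2 ^ j\<close> and \<open>r\<close> of order
  \<open>n powr (1 / 3) * ln n powr (- (1 / 3) - \<epsilon>)\<close> this is summable in \<open>j\<close>.

  Upper bound: let \<open>W\<close> be the sum of \<open>exp (\<theta> * (x - y))\<close> over all particles \<open>x\<close> and holes \<open>y\<close>.  It
  is finite and invariant under translations, and it is at least \<open>exp (\<theta> * (\<bar>S\<bar> - 1))\<close>, where
  \<open>\<bar>S\<bar>\<close> is the size of the zone.  Exponentials are eigenfunctions of the discrete Laplacian, so
  the mean of \<open>W + 1\<close> grows by a factor of at most \<open>1 + (2 * cosh \<theta> - 2)\<close> per step
  (lemma \<open>zone_spread_drift\<close>).  The maximal inequality bounds the probability that the size
  exceeds \<open>r\<close> up to time \<open>t\<close>, for \<open>\<theta> \<le> 1\<close>, by \<open>\<theta> powr (- 2) * exp (2 * \<theta>\<^sup>2 * t - \<theta> * r)\<close> times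
  a constant that depends on the initial configuration (lemmas \<open>large_zone_prob\<close> and
  \<open>zone_spread_bounds\<close>).  For \<open>\<theta> = sqrt (ln t / t)\<close> and \<open>r\<close> the claimed upper bound, the
  exponent is \<open>2 * ln t - ln t powr (1 + \<epsilon>)\<close>, so the bound is summable in \<open>t\<close>.

  The Borel-Cantelli lemma gives the almost sure statements in both cases.
\<close>


section \<open>Confinement of a Markov chain to a set\<close>

text \<open>
  The probability that the chain started at \<open>x\<close> stays in \<open>A\<close> at the times \<open>0, \<dots>, n\<close>, by the
  decomposition at the first step.  Both halves of the theorem only ask for such probabilities,
  so this recursion replaces stopping times and martingales on the path space: a drift condition
  becomes a bound by induction on \<open>n\<close>.
\<close>
primrec confinement_prob :: "('s \<Rightarrow> 's pmf) \<Rightarrow> 's set \<Rightarrow> nat \<Rightarrow> 's \<Rightarrow> real" where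
  "confinement_prob K A 0 x = indicator A x"
| "confinement_prob K A (Suc n) x =
     indicator A x * measure_pmf.expectation (K x) (confinement_prob K A n)"

lemma confinement_prob_nonneg: "0 \<le> confinement_prob K A n x"
  by (induction n arbitrary: x) auto

lemma confinement_prob_le_1: "confinement_prob K A n x \<le> 1"
proof (induction n arbitrary: x)
  case (Suc n)
  have "measure_pmf.expectation (K x) (confinement_prob K A n) \<le> 1"
    by (rule measure_pmf.integral_le_const)
       (auto intro!: measure_pmf.integrable_const_bound[where B = 1] AE_I2
             simp: confinement_prob_nonneg Suc)
  then show ?case by (simp add: indicator_def)
qed (simp add: indicator_def)

lemma integrable_confinement_prob: "integrable (measure_pmf p) (confinement_prob K A n)"
  by (rule measure_pmf.integrable_const_bound[where B = 1])
     (auto simp: confinement_prob_nonneg confinement_prob_le_1)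

lemma confinement_prob_antimono: "confinement_prob K A (Suc n) x \<le> confinement_prob K A n x"
proof (induction n arbitrary: x)
  case 0
  show ?case
    using confinement_prob_le_1[of K A "Suc 0" x] by (auto simp: indicator_def)
next
  case (Suc n)
  have "measure_pmf.expectation (K x) (confinement_prob K A (Suc n))
      \<le> measure_pmf.expectation (K x) (confinement_prob K A n)"
    by (intro integral_mono integrable_confinement_prob Suc)
  then show ?case
    by (simp only: confinement_prob.simps(2)[of K A "Suc n" x] confinement_prob.simps(2)[of K A n x])
       (intro mult_left_mono, auto)
qed

text \<open>
  The finite-dimensional laws of the chain are known only for prefixes \<open>X 0 = x 0, \<dots>, X m = x m\<close>,
  so the induction on \<open>n\<close> runs for an arbitrary prefix that is followed by \<open>n\<close> steps inside \<open>A\<close>: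
  splitting by the value of \<open>X (Suc m)\<close>, of which there are countably many, lengthens the prefix
  by one and shortens the rest.
\<close>
lemma markov_chain_confined:
  fixes X :: "nat \<Rightarrow> 'w \<Rightarrow> 's::countable"
  assumes "markov_chain M K s X"
  shows "measure M {\<omega> \<in> space M. \<forall>i\<le>n. X i \<omega> \<in> A} = confinement_prob K A n s"
proof -
  interpret prob_space M
    using assms by (simp add: markov_chain_def)
  have X[measurable]: "X i \<in> measurable M (count_space UNIV)" for i
    using assms by (simp add: markov_chain_def)
  have start: "AE \<omega> in M. X 0 \<omega> = s"
    using assms by (simp add: markov_chain_def)
  have step: "emeasure M {\<omega> \<in> space M. \<forall>i\<le>Suc m. X i \<omega> = x i} =
      emeasure M {\<omega> \<in> space M. \<forall>i\<le>m. X i \<omega> = x i} * ennreal (pmf (K (x m)) (x (Suc m)))" for m x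
    using assms by (simp add: markov_chain_def emeasure_eq_measure ennreal_mult)
  have prefix: "emeasure M {\<omega> \<in> space M. (\<forall>i\<le>m. X i \<omega> = x i) \<and> (\<forall>i\<in>{m..m + n}. X i \<omega> \<in> A)} =
      emeasure M {\<omega> \<in> space M. \<forall>i\<le>m. X i \<omega> = x i} * ennreal (confinement_prob K A n (x m))" for m x
  proof (induction n arbitrary: m x)
    case 0
    have "{\<omega> \<in> space M. (\<forall>i\<le>m. X i \<omega> = x i) \<and> (\<forall>i\<in>{m..m + 0}. X i \<omega> \<in> A)} =
        (if x m \<in> A then {\<omega> \<in> space M. \<forall>i\<le>m. X i \<omega> = x i} else {})"
      by auto
    then show ?case by simp
  next
    case (Suc n)
    show ?case
    proof (cases "x m \<in> A")
      case False
      then have "{\<omega> \<in> space M. (\<forall>i\<le>m. X i \<omega> = x i) \<and> (\<forall>i\<in>{m..m + Suc n}. X i \<omega> \<in> A)} = {}"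
        by force
      with False show ?thesis by (simp del: Collect_empty_eq)
    next
      case True
      let ?E = "\<lambda>y. {\<omega> \<in> space M. (\<forall>i\<le>Suc m. X i \<omega> = (x(Suc m := y)) i) \<and>
          (\<forall>i\<in>{Suc m..Suc m + n}. X i \<omega> \<in> A)}"
      have "{\<omega> \<in> space M. (\<forall>i\<le>m. X i \<omega> = x i) \<and> (\<forall>i\<in>{m..m + Suc n}. X i \<omega> \<in> A)} = (\<Union>y. ?E y)"
      proof (intro equalityI subsetI)
        fix \<omega> assume w: "\<omega> \<in> {\<omega> \<in> space M. (\<forall>i\<le>m. X i \<omega> = x i) \<and> (\<forall>i\<in>{m..m + Suc n}. X i \<omega> \<in> A)}"
        then have "\<omega> \<in> ?E (X (Suc m) \<omega>)"
          by (auto simp: le_Suc_eq)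
        then show "\<omega> \<in> (\<Union>y. ?E y)" by blast
      next
        fix \<omega> assume "\<omega> \<in> (\<Union>y. ?E y)"
        then obtain y where y: "\<omega> \<in> ?E y" by blast
        have pre: "X i \<omega> = x i" if "i \<le> m" for i
        proof -
          have "X i \<omega> = (x(Suc m := y)) i" using y that le_SucI[OF that] by blast
          then show ?thesis using that by simp
        qed
        have "X i \<omega> \<in> A" if "i \<in> {m..m + Suc n}" for i
          using y that True pre[of m] by (cases "i = m") auto
        with y pre show "\<omega> \<in> {\<omega> \<in> space M. (\<forall>i\<le>m. X i \<omega> = x i) \<and> (\<forall>i\<in>{m..m + Suc n}. X i \<omega> \<in> A)}"
          by blast
      qed
      then have "emeasure M {\<omega> \<in> space M. (\<forall>i\<le>m. X i \<omega> = x i) \<and> (\<forall>i\<in>{m..m + Suc n}. X i \<omega> \<in> A)} =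
          emeasure M (\<Union>y. ?E y)" by simp
      also have "\<dots> = (\<integral>\<^sup>+y. emeasure M (?E y) \<partial>count_space UNIV)"
      proof (rule emeasure_UN_countable)
        show "disjoint_family ?E"
          unfolding disjoint_family_on_def by auto
      qed auto
      also have "\<dots> = (\<integral>\<^sup>+y. emeasure M {\<omega> \<in> space M. \<forall>i\<le>m. X i \<omega> = x i} *
          (ennreal (pmf (K (x m)) y) * ennreal (confinement_prob K A n y)) \<partial>count_space UNIV)"
      proof (intro nn_integral_cong)
        fix y
        have "{\<omega> \<in> space M. \<forall>i\<le>m. X i \<omega> = (x(Suc m := y)) i} = {\<omega> \<in> space M. \<forall>i\<le>m. X i \<omega> = x i}"
          by auto
        then show "emeasure M (?E y) = emeasure M {\<omega> \<in> space M. \<forall>i\<le>m. X i \<omega> = x i} *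
          (ennreal (pmf (K (x m)) y) * ennreal (confinement_prob K A n y))"
          unfolding Suc step by (simp add: mult.assoc)
      qed
      also have "\<dots> = emeasure M {\<omega> \<in> space M. \<forall>i\<le>m. X i \<omega> = x i} *
          (\<integral>\<^sup>+y. ennreal (confinement_prob K A n y) \<partial>measure_pmf (K (x m)))"
        by (subst nn_integral_cmult) (auto simp: nn_integral_measure_pmf)
      also have "(\<integral>\<^sup>+y. ennreal (confinement_prob K A n y) \<partial>measure_pmf (K (x m))) =
          ennreal (measure_pmf.expectation (K (x m)) (confinement_prob K A n))"
        by (intro nn_integral_eq_integral integrable_confinement_prob)
           (auto simp: confinement_prob_nonneg)
      finally show ?thesis using True by simp
    qed
  qed
  have "emeasure M {\<omega> \<in> space M. \<forall>i\<le>0::nat. X i \<omega> = s} = 1"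
    using start by (subst emeasure_eq_1_AE) auto
  then have "emeasure M {\<omega> \<in> space M. (\<forall>i\<le>0. X i \<omega> = s) \<and> (\<forall>i\<in>{0..0 + n}. X i \<omega> \<in> A)} =
      ennreal (confinement_prob K A n s)"
    using prefix[of 0 "\<lambda>_. s"] by simp
  also have "emeasure M {\<omega> \<in> space M. (\<forall>i\<le>0. X i \<omega> = s) \<and> (\<forall>i\<in>{0..0 + n}. X i \<omega> \<in> A)} =
      emeasure M {\<omega> \<in> space M. \<forall>i\<le>n. X i \<omega> \<in> A}"
    using start by (intro emeasure_eq_AE) auto
  finally show ?thesis
    by (simp add: emeasure_eq_measure confinement_prob_nonneg)
qed

text \<open>
  The maximal inequality for the nonnegative supermartingale \<open>g (X n) / c ^ n\<close>: reaching the
  complement of \<open>A\<close> requires \<open>g \<ge> 1\<close>, and the mean of \<open>g\<close> grows by a factor of at most \<open>c\<close> per step.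
\<close>
lemma escape_le_if_expectation_grows_slowly:
  assumes fin: "\<And>x. finite (set_pmf (K x))"
    and nonneg: "\<And>x. 0 \<le> g x" and outside: "\<And>x. x \<notin> A \<Longrightarrow> 1 \<le> g x"
    and drift: "\<And>x. measure_pmf.expectation (K x) g \<le> c * g x" and "1 \<le> c"
  shows "1 - confinement_prob K A n x \<le> c ^ n * g x"
proof (induction n arbitrary: x)
  case 0
  show ?case using nonneg[of x] outside[of x] by (cases "x \<in> A") auto
next
  case (Suc n)
  show ?case
  proof (cases "x \<in> A")
    case False
    have "1 * 1 \<le> c ^ Suc n * g x"
      using outside[OF False] \<open>1 \<le> c\<close> by (intro mult_mono one_le_power) auto
    with False show ?thesis by simp
  next
    case True
    note [simp] = integrable_measure_pmf_finite[OF fin]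
    have "1 - confinement_prob K A (Suc n) x =
        measure_pmf.expectation (K x) (\<lambda>y. 1 - confinement_prob K A n y)"
      using True by simp
    also have "\<dots> \<le> measure_pmf.expectation (K x) (\<lambda>y. c ^ n * g y)"
      by (intro integral_mono Suc) simp_all
    also have "\<dots> \<le> c ^ n * (c * g x)"
      using drift \<open>1 \<le> c\<close> by (simp add: mult_left_mono)
    finally show ?thesis by (simp add: mult.assoc mult.commute mult.left_commute)
  qed
qed

text \<open>
  While the chain is in \<open>A\<close>, the mean of \<open>g\<close> gains at least \<open>d\<close> per step, but \<open>g\<close> cannot exceed \<open>H\<close>
  up to and including the step that leaves \<open>A\<close>.  So the expected time spent in \<open>A\<close> before leaving
  it, which is the sum of the confinement probabilities, is at most \<open>H / d\<close>; these probabilities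
  decrease in time, so the sum dominates \<open>n\<close> copies of the last one.
\<close>
lemma confinement_le_if_drift_bounded_below:
  assumes fin: "\<And>x. finite (set_pmf (K x))" and "0 < d"
    and drift: "\<And>x. x \<in> A \<Longrightarrow> g x + d \<le> measure_pmf.expectation (K x) g"
    and bound: "\<And>x. x \<in> A \<Longrightarrow> g x \<le> H" "\<And>x y. x \<in> A \<Longrightarrow> y \<in> set_pmf (K x) \<Longrightarrow> g y \<le> H"
    and "0 \<le> g x" "0 \<le> H"
  shows "real n * confinement_prob K A n x \<le> H / d"
proof -
  note [simp] = integrable_measure_pmf_finite[OF fin]
  \<comment> \<open>The sharper bound \<open>H - g x\<close> is the one that is preserved by a step.\<close>
  have sums: "(\<Sum>m<n. confinement_prob K A m x) \<le> (H - g x) / d" if "g x \<le> H" for n x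
    using that
  proof (induction n arbitrary: x)
    case 0
    then show ?case using \<open>0 < d\<close> by simp
  next
    case (Suc n)
    show ?case
    proof (cases "x \<in> A")
      case False
      then have "confinement_prob K A m x = 0" for m
        by (cases m) auto
      then show ?thesis using Suc.prems \<open>0 < d\<close> by simp
    next
      case True
      have "(\<Sum>m<Suc n. confinement_prob K A m x) =
          1 + measure_pmf.expectation (K x) (\<lambda>y. \<Sum>m<n. confinement_prob K A m y)"
        using True by (simp add: sum.lessThan_Suc_shift integrable_confinement_prob
            del: sum.lessThan_Suc)
      also have "\<dots> \<le> 1 + measure_pmf.expectation (K x) (\<lambda>y. (H - g y) / d)"
        using Suc.IH bound(2)[OF True]
        by (intro add_left_mono integral_mono_AE) (auto simp: AE_measure_pmf_iff)
      also have "\<dots> = 1 + (H - measure_pmf.expectation (K x) g) / d"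
        by simp
      also have "\<dots> \<le> 1 + (H - (g x + d)) / d"
        using drift[OF True] \<open>0 < d\<close> by (intro add_left_mono divide_right_mono) auto
      also have "\<dots> = (H - g x) / d"
        using \<open>0 < d\<close> by (simp add: field_simps)
      finally show ?thesis .
    qed
  qed
  show ?thesis
  proof (cases "x \<in> A")
    case False
    then have "confinement_prob K A n x = 0"
      by (cases n) auto
    then show ?thesis using \<open>0 < d\<close> \<open>0 \<le> H\<close> by simp
  next
    case True
    have dec: "decseq (\<lambda>m. confinement_prob K A m x)"
      by (intro decseq_SucI confinement_prob_antimono)
    then have "(\<Sum>m<n. confinement_prob K A n x) \<le> (\<Sum>m<n. confinement_prob K A m x)"
      using decseqD[OF dec] by (intro sum_mono) simp
    also have "\<dots> \<le> (H - g x) / d" using sums bound(1)[OF True] by blast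
    also have "\<dots> \<le> H / d" using \<open>0 \<le> g x\<close> \<open>0 < d\<close> by (simp add: divide_right_mono)
    finally show ?thesis by simp
  qed
qed


section \<open>Symmetric exclusion as exchanges of unlike neighbours\<close>

definition swap_sites :: "int \<Rightarrow> config \<Rightarrow> config" where
  "swap_sites x S = S \<circ> Transposition.transpose x (x + 1)"

lemma swap_sites_in_zone_configs:
  assumes "S \<in> zone_configs"
  shows "swap_sites x S \<in> zone_configs"
proof -
  have "swap_sites x S = S(x := S (x + 1), x + 1 := S x)"
    by (auto simp: fun_eq_iff swap_sites_def Transposition.transpose_def)
  then show ?thesis
    using assms by (simp add: fun_upd_in_zone_configs)
qed

text \<open>
  For \<open>p = 1 / 2\<close> both kinds of unlike pairs are exchanged with the same probability, so the step
  does not distinguish them.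
\<close>
lemma config_step_symmetric_exclusion:
  assumes "S \<in> zone_configs"
  shows "config_step 0 (1 / 2) S =
    pmf_of_set (unlike_pairs S) \<bind> (\<lambda>x. map_pmf (\<lambda>b. if b then swap_sites x S else S) (bernoulli_pmf (1 / 2)))"
proof -
  have "exclusion_move (1 / 2) S x = map_pmf (\<lambda>b. if b then swap_sites x S else S) (bernoulli_pmf (1 / 2))"
    if "x \<in> set_pmf (pmf_of_set (unlike_pairs S))" for x
  proof -
    have x: "S x \<noteq> S (x + 1)"
      using that finite_unlike_pairs[OF assms] unlike_pairs_nonempty[OF assms]
      by (simp add: unlike_pairs_def)
    show ?thesis
    proof (cases "S x")
      case True
      with x have "swap_sites x S = S(x := False, x + 1 := True)"
        by (auto simp: fun_eq_iff swap_sites_def Transposition.transpose_def)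
      then show ?thesis using True by (simp add: exclusion_move_def cong: if_cong)
    next
      case False
      with x have "swap_sites x S = S(x := True, x + 1 := False)"
        by (auto simp: fun_eq_iff swap_sites_def Transposition.transpose_def)
      then show ?thesis using False x by (simp add: exclusion_move_def cong: if_cong)
    qed
  qed
  moreover have "bernoulli_pmf 0 = return_pmf False"
    by (rule pmf_eqI) (auto split: bool.split simp: pmf_bernoulli_False indicator_def)
  ultimately show ?thesis
    by (auto simp: config_step_def bind_return_pmf intro!: bind_pmf_cong)
qed

text \<open>
  The sign is 1 for a pair 10 and -1 for a pair 01: the exchange carries a particle to the right
  or to the left.
\<close>
definition current_sign :: "config \<Rightarrow> int \<Rightarrow> real" where
  "current_sign S x = of_bool (S x) - of_bool (S (x + 1))"

lemma zone_extremes: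
  assumes S: "S \<in> zone_configs"
  shows "\<not> S (leftmost_zero S)" "x < leftmost_zero S \<Longrightarrow> S x"
    "S (rightmost_one S)" "x > rightmost_one S \<Longrightarrow> \<not> S x"
    "leftmost_zero S \<le> rightmost_one S + 1"
proof -
  obtain a b where ab: "\<And>x. x \<le> a \<Longrightarrow> S x" "\<And>x. x \<ge> b \<Longrightarrow> \<not> S x"
    using zone_configs_bounds[OF assms] by metis
  have below: "bdd_below {x. \<not> S x}" "{x. \<not> S x} \<noteq> {}"
    and above: "bdd_above {x. S x}" "{x. S x} \<noteq> {}"
    using ab by (auto intro!: bdd_belowI[of _ a] bdd_aboveI[of _ b]) (meson linorder_linear)+
  show ones: "S x" if "x < leftmost_zero S" for x
    using cInf_lower[OF _ below(1), of x] that by (force simp: leftmost_zero_def)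
  show "\<not> S (leftmost_zero S)"
  proof -
    have "Inf {x. \<not> S x} < leftmost_zero S + 1" by (simp add: leftmost_zero_def)
    then obtain y where "\<not> S y" "y < leftmost_zero S + 1"
      using cInf_less_iff[OF below(2,1)] by blast
    moreover from this have "y = leftmost_zero S"
      using cInf_lower[OF _ below(1), of y] by (simp add: leftmost_zero_def)
    ultimately show ?thesis by simp
  qed
  show "S (rightmost_one S)"
  proof -
    have "rightmost_one S - 1 < Sup {x. S x}" by (simp add: rightmost_one_def)
    then obtain y where "S y" "rightmost_one S - 1 < y"
      using less_cSup_iff[OF above(2,1)] by blast
    moreover from this have "y = rightmost_one S"
      using cSup_upper[OF _ above(1), of y] by (simp add: rightmost_one_def)
    ultimately show ?thesis by simp
  qed
  show "\<not> S x" if "x > rightmost_one S" for x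
    using cSup_upper[OF _ above(1), of x] that by (force simp: rightmost_one_def)
  show "leftmost_zero S \<le> rightmost_one S + 1"
    using cSup_upper[OF _ above(1), of "leftmost_zero S - 1"] ones by (simp add: rightmost_one_def)
qed

lemma config_size_eq:
  "S \<in> zone_configs \<Longrightarrow> int (config_size S) = rightmost_one S - leftmost_zero S + 1"
  using zone_extremes(5)[of S] by (simp add: config_size_def)

lemma card_unlike_pairs_le:
  assumes S: "S \<in> zone_configs"
  shows "card (unlike_pairs S) \<le> config_size S + 1"
proof -
  have "unlike_pairs S \<subseteq> {leftmost_zero S - 1..rightmost_one S}"
  proof
    fix x assume "x \<in> unlike_pairs S"
    then have "S x \<noteq> S (x + 1)" by (simp add: unlike_pairs_def)
    then show "x \<in> {leftmost_zero S - 1..rightmost_one S}"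
      using zone_extremes(2)[OF S, of x] zone_extremes(2)[OF S, of "x + 1"]
        zone_extremes(4)[OF S, of x] zone_extremes(4)[OF S, of "x + 1"] by fastforce
  qed
  then have "card (unlike_pairs S) \<le> card {leftmost_zero S - 1..rightmost_one S}"
    by (rule card_mono[rotated]) simp
  also have "\<dots> = config_size S + 1"
    using config_size_eq[OF S] by simp
  finally show ?thesis .
qed

text \<open>
  Read from left to right, the unlike pairs alternate, beginning and ending with 10.
\<close>
lemma sum_current_sign:
  assumes S: "S \<in> zone_configs"
  shows "(\<Sum>x\<in>unlike_pairs S. current_sign S x) = 1"
proof -
  obtain a b where ab: "a < b" "\<And>x. x \<le> a \<Longrightarrow> S x" "\<And>x. x \<ge> b \<Longrightarrow> \<not> S x"
    using zone_configs_bounds[OF S] by metis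
  have telescope: "(\<Sum>x\<in>{a..<a + int n}. current_sign S x) = of_bool (S a) - of_bool (S (a + int n))" for n
  proof (induction n)
    case (Suc n)
    have "{a..<a + int (Suc n)} = insert (a + int n) {a..<a + int n}" by auto
    with Suc show ?case by (simp add: current_sign_def add.commute add.left_commute)
  qed simp
  have "(\<Sum>x\<in>unlike_pairs S. current_sign S x) = (\<Sum>x\<in>{a..<b}. current_sign S x)"
  proof (rule sum.mono_neutral_left)
    show "unlike_pairs S \<subseteq> {a..<b}"
    proof
      fix x assume "x \<in> unlike_pairs S"
      then have "S x \<noteq> S (x + 1)" by (simp add: unlike_pairs_def)
      then show "x \<in> {a..<b}"
        using ab(2)[of x] ab(2)[of "x + 1"] ab(3)[of x] ab(3)[of "x + 1"] by fastforce
    qed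
  qed (auto simp: unlike_pairs_def current_sign_def)
  also have "\<dots> = 1"
    using telescope[of "nat (b - a)"] ab by simp
  finally show ?thesis .
qed


section \<open>Inversions\<close>

definition inversions :: "config \<Rightarrow> (int \<times> int) set" where
  "inversions S = {(u, v). u < v \<and> \<not> S u \<and> S v}"

lemma inversions_subset:
  assumes S: "S \<in> zone_configs"
  shows "inversions S \<subseteq> {leftmost_zero S..rightmost_one S} \<times> {leftmost_zero S..rightmost_one S}"
proof (clarsimp simp: inversions_def)
  fix u v assume "u < v" "\<not> S u" "S v"
  then show "leftmost_zero S \<le> u \<and> u \<le> rightmost_one S \<and> leftmost_zero S \<le> v \<and> v \<le> rightmost_one S"
    using zone_extremes(2)[OF S, of u] zone_extremes(4)[OF S, of v] by fastforce
qed

lemma finite_inversions: "S \<in> zone_configs \<Longrightarrow> finite (inversions S)"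
  using inversions_subset by (rule finite_subset) auto

lemma card_inversions_le:
  assumes S: "S \<in> zone_configs"
  shows "card (inversions S) \<le> (config_size S)\<^sup>2"
proof -
  have "card (inversions S) \<le> card ({leftmost_zero S..rightmost_one S} \<times> {leftmost_zero S..rightmost_one S})"
    by (intro card_mono inversions_subset S) simp
  also have "\<dots> = (config_size S)\<^sup>2"
    by (simp add: card_cartesian_product power2_eq_square config_size_def)
  finally show ?thesis .
qed

text \<open>
  The exchange, applied to both coordinates, matches the inversions before and after it, except
  for the exchanged pair \<open>(x, x + 1)\<close> itself, which is an inversion either only before or only
  after.
\<close>
lemma card_inversions_swap_sites:
  assumes S: "S \<in> zone_configs" and x: "x \<in> unlike_pairs S"
  shows "real (card (inversions (swap_sites x S))) = real (card (inversions S)) + current_sign S x"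
proof -
  let ?\<tau> = "Transposition.transpose x (x + 1)"
  let ?p = "(x, x + 1)"
  have bij: "bij_betw (map_prod ?\<tau> ?\<tau>) (inversions (swap_sites x S) - {?p}) (inversions S - {?p})"
  proof (rule bij_betw_byWitness[where f' = "map_prod ?\<tau> ?\<tau>"])
    have lt: "?\<tau> u < ?\<tau> v" "(?\<tau> u, ?\<tau> v) \<noteq> ?p" if "u < v" "(u, v) \<noteq> ?p" for u v
      using that by (auto simp: Transposition.transpose_def)
    show "map_prod ?\<tau> ?\<tau> ` (inversions (swap_sites x S) - {?p}) \<subseteq> inversions S - {?p}"
      using lt by (auto simp: inversions_def swap_sites_def simp del: prod.inject)
    show "map_prod ?\<tau> ?\<tau> ` (inversions S - {?p}) \<subseteq> inversions (swap_sites x S) - {?p}"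
      using lt by (auto simp: inversions_def swap_sites_def simp del: prod.inject)
  qed auto
  have split: "real (card (inversions T)) = real (card (inversions T - {?p})) + of_bool (?p \<in> inversions T)"
    if "T \<in> zone_configs" for T
    using finite_inversions[OF that] card_Suc_Diff1[of "inversions T" ?p] by auto
  have "real (card (inversions (swap_sites x S))) - of_bool (?p \<in> inversions (swap_sites x S)) =
      real (card (inversions S)) - of_bool (?p \<in> inversions S)"
    using bij_betw_same_card[OF bij] split[OF S] split[OF swap_sites_in_zone_configs[OF S, of x]] by simp
  then show ?thesis
    using x by (auto simp: inversions_def swap_sites_def current_sign_def unlike_pairs_def split: if_splits)
qed


section \<open>Exponential weights of particles and holes\<close>

definition exp_weight :: "real \<Rightarrow> int set \<Rightarrow> real" where
  "exp_weight \<theta> A = (\<Sum>\<^sub>\<infinity>x\<in>A. exp (\<theta> * of_int x))"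

lemma exp_summable_on_bounded_above:
  fixes \<theta> :: real
  assumes "0 < \<theta>" "A \<subseteq> {..b}"
  shows "(\<lambda>x. exp (\<theta> * of_int x)) summable_on A"
proof -
  have "summable (\<lambda>n. exp (\<theta> * of_int b) * exp (- \<theta>) ^ n)"
    using \<open>0 < \<theta>\<close> by (intro summable_mult summable_geometric[of "exp (- \<theta>)"]) auto
  also have "(\<lambda>n. exp (\<theta> * of_int b) * exp (- \<theta>) ^ n) =
      (\<lambda>x::int. exp (\<theta> * of_int x)) \<circ> (\<lambda>n. b - int n)"
    by (auto simp: fun_eq_iff algebra_simps simp flip: exp_add exp_of_nat_mult)
  finally have "((\<lambda>x. exp (\<theta> * of_int x)) \<circ> (\<lambda>n. b - int n)) summable_on UNIV"
    by (subst summable_on_UNIV_nonneg_real_iff) (auto simp: o_def)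
  then have "(\<lambda>x. exp (\<theta> * of_int x)) summable_on range (\<lambda>n. b - int n)"
    by (subst summable_on_reindex) (auto simp: inj_on_def)
  moreover have "A \<subseteq> range (\<lambda>n. b - int n)"
  proof
    fix x assume "x \<in> A"
    then have "x = b - int (nat (b - x))" using assms(2) by auto
    then show "x \<in> range (\<lambda>n. b - int n)" by blast
  qed
  ultimately show ?thesis
    by (rule summable_on_subset_banach)
qed

lemma exp_summable_on_uminus:
  fixes \<theta> :: real and A :: "int set"
  assumes "(\<lambda>x. exp (\<theta> * of_int x)) summable_on (uminus ` A)"
  shows "(\<lambda>x. exp (- \<theta> * of_int x)) summable_on A"
  using assms by (subst (asm) summable_on_reindex) (auto simp: o_def)

lemma exp_weight_shift:
  "exp_weight \<theta> {x. x + k \<in> A} = exp (- \<theta> * of_int k) * exp_weight \<theta> A"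
proof -
  have "{x. x + k \<in> A} = (\<lambda>x. x - k) ` A"
    by (force simp: image_iff)
  then have "exp_weight \<theta> {x. x + k \<in> A} = (\<Sum>\<^sub>\<infinity>x\<in>A. exp (- \<theta> * of_int k) * exp (\<theta> * of_int x))"
    unfolding exp_weight_def
    by (simp add: infsum_reindex inj_on_def o_def algebra_simps flip: exp_add)
  then show ?thesis by (simp add: exp_weight_def infsum_cmult_right')
qed

lemma exp_weight_nonneg: "0 \<le> exp_weight \<theta> A"
  by (simp add: exp_weight_def infsum_nonneg)

lemma exp_weight_ge:
  assumes "(\<lambda>x. exp (\<theta> * of_int x)) summable_on A" "x \<in> A"
  shows "exp (\<theta> * of_int x) \<le> exp_weight \<theta> A"
  using finite_sum_le_infsum[OF assms(1), of "{x}"] assms(2) by (simp add: exp_weight_def)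

text \<open>
  Of the two sites exchanged exactly one lies in \<open>A\<close>, so a single summand moves.
\<close>
lemma infsum_transposed:
  fixes f :: "int \<Rightarrow> real"
  assumes f: "f summable_on A" and x: "(x \<in> A) \<noteq> (x + 1 \<in> A)"
  shows "infsum f {y. Transposition.transpose x (x + 1) y \<in> A} =
    infsum f A + (of_bool (x \<in> A) - of_bool (x + 1 \<in> A)) * (f (x + 1) - f x)"
proof -
  define C where "C = A - {x, x + 1}"
  have C: "f summable_on C" "x \<notin> C" "x + 1 \<notin> C"
    using summable_on_subset_banach[OF f] by (auto simp: C_def)
  show ?thesis
  proof (cases "x \<in> A")
    case True
    with x have "A = insert x C" "{y. Transposition.transpose x (x + 1) y \<in> A} = insert (x + 1) C"
      by (auto simp: C_def Transposition.transpose_def split: if_splits)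
    with C True x show ?thesis by (simp add: infsum_insert)
  next
    case False
    with x have "A = insert (x + 1) C" "{y. Transposition.transpose x (x + 1) y \<in> A} = insert x C"
      by (auto simp: C_def Transposition.transpose_def split: if_splits)
    with C False x show ?thesis by (simp add: infsum_insert)
  qed
qed

text \<open>
  Summation by parts: the sum of the weight over \<open>A\<close> minus that over \<open>A - 1\<close> leaves only the
  finitely many boundary points, while shifting \<open>A\<close> by one multiplies its weight by \<open>exp (- \<theta>)\<close>.  It turns sums
  over unlike pairs back into the weights themselves.
\<close>
lemma exp_weight_boundary_sum:
  fixes \<theta> :: real
  assumes sA: "(\<lambda>x. exp (\<theta> * of_int x)) summable_on A"
    and sB: "(\<lambda>x. exp (\<theta> * of_int x)) summable_on {x. x + 1 \<in> A}"
    and fin: "finite {x. (x \<in> A) \<noteq> (x + 1 \<in> A)}"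
  shows "(\<Sum>x\<in>{x. (x \<in> A) \<noteq> (x + 1 \<in> A)}. (of_bool (x \<in> A) - of_bool (x + 1 \<in> A)) * exp (\<theta> * of_int x)) =
    (1 - exp (- \<theta>)) * exp_weight \<theta> A"
proof -
  let ?f = "\<lambda>x::int. exp (\<theta> * of_int x)"
  let ?D = "{x. (x \<in> A) \<noteq> (x + 1 \<in> A)}"
  let ?B = "{x. x + 1 \<in> A}"
  have finite_diff: "finite (A - ?B)" "finite (?B - A)"
    by (rule finite_subset[OF _ fin], blast)+
  have common: "?f summable_on (A \<inter> ?B)"
    using sA by (rule summable_on_subset_banach) blast
  have "infsum ?f A = infsum ?f (A \<inter> ?B) + (\<Sum>x\<in>A - ?B. ?f x)"
  proof -
    have "A \<inter> ?B \<union> (A - ?B) = A" by blast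
    then show ?thesis
      using infsum_Un_disjoint[OF common summable_on_finite[OF finite_diff(1)]] finite_diff
      by auto
  qed
  moreover have "infsum ?f ?B = infsum ?f (A \<inter> ?B) + (\<Sum>x\<in>?B - A. ?f x)"
  proof -
    have "A \<inter> ?B \<union> (?B - A) = ?B" by blast
    then show ?thesis
      using infsum_Un_disjoint[OF common summable_on_finite[OF finite_diff(2)]] finite_diff
      by auto
  qed
  moreover have "(\<Sum>x\<in>?D. (of_bool (x \<in> A) - of_bool (x + 1 \<in> A)) * ?f x) =
      (\<Sum>x\<in>A - ?B. ?f x) - (\<Sum>x\<in>?B - A. ?f x)"
  proof -
    have "?D = (A - ?B) \<union> (?B - A)" by blast
    then have "(\<Sum>x\<in>?D. (of_bool (x \<in> A) - of_bool (x + 1 \<in> A)) * ?f x) =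
      (\<Sum>x\<in>A - ?B. (of_bool (x \<in> A) - of_bool (x + 1 \<in> A)) * ?f x) +
      (\<Sum>x\<in>?B - A. (of_bool (x \<in> A) - of_bool (x + 1 \<in> A)) * ?f x)"
      using finite_diff by (simp only:) (subst sum.union_disjoint, auto)
    then show ?thesis
      by (simp add: sum_negf)
  qed
  moreover have "infsum ?f ?B = exp (- \<theta>) * infsum ?f A"
    using exp_weight_shift[of \<theta> 1 A] by (simp add: exp_weight_def)
  ultimately show ?thesis
    by (simp add: exp_weight_def algebra_simps)
qed

text \<open>
  The product of the weight \<open>exp (\<theta> * x)\<close> summed over the particles and \<open>exp (- \<theta> * x)\<close> summed over
  the holes, that is, the sum of \<open>exp (\<theta> * (x - y))\<close> over all particles \<open>x\<close> and holes \<open>y\<close>.  Neither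
  factor is invariant under translations, but the product is.
\<close>
definition spread_weight :: "real \<Rightarrow> config \<Rightarrow> real" where
  "spread_weight \<theta> S = exp_weight \<theta> {x. S x} * exp_weight (- \<theta>) {x. \<not> S x}"

lemma summable_on_ones_zeros:
  fixes \<theta> :: real
  assumes "S \<in> zone_configs" "0 < \<theta>"
  shows "(\<lambda>x. exp (\<theta> * of_int x)) summable_on {x. S x}"
    "(\<lambda>x. exp (\<theta> * of_int x)) summable_on {x. S (x + 1)}"
    "(\<lambda>x. exp (- \<theta> * of_int x)) summable_on {x. \<not> S x}"
    "(\<lambda>x. exp (- \<theta> * of_int x)) summable_on {x. \<not> S (x + 1)}"
proof -
  have ones: "S x \<Longrightarrow> x \<le> rightmost_one S" and zeros: "\<not> S x \<Longrightarrow> leftmost_zero S \<le> x" for x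
    using zone_extremes(2,4)[OF assms(1)] by (force simp: not_less[symmetric])+
  show "(\<lambda>x. exp (\<theta> * of_int x)) summable_on {x. S x}"
    using ones by (intro exp_summable_on_bounded_above[where b = "rightmost_one S"] assms) auto
  show "(\<lambda>x. exp (\<theta> * of_int x)) summable_on {x. S (x + 1)}"
    using ones by (intro exp_summable_on_bounded_above[where b = "rightmost_one S"] assms) force
  show "(\<lambda>x. exp (- \<theta> * of_int x)) summable_on {x. \<not> S x}"
    using zeros
    by (intro exp_summable_on_uminus exp_summable_on_bounded_above[where b = "- leftmost_zero S"] assms) auto
  show "(\<lambda>x. exp (- \<theta> * of_int x)) summable_on {x. \<not> S (x + 1)}"
    using zeros
    by (intro exp_summable_on_uminus exp_summable_on_bounded_above[where b = "1 - leftmost_zero S"] assms) force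
qed

lemma boundary_sums:
  assumes S: "S \<in> zone_configs" and "0 < \<theta>"
  shows "(\<Sum>x\<in>unlike_pairs S. current_sign S x * exp (\<theta> * of_int x)) =
      (1 - exp (- \<theta>)) * exp_weight \<theta> {x. S x}"
    "(\<Sum>x\<in>unlike_pairs S. current_sign S x * exp (- \<theta> * of_int x)) =
      (exp \<theta> - 1) * exp_weight (- \<theta>) {x. \<not> S x}"
proof -
  note summable = summable_on_ones_zeros[OF S \<open>0 < \<theta>\<close>]
  show "(\<Sum>x\<in>unlike_pairs S. current_sign S x * exp (\<theta> * of_int x)) =
      (1 - exp (- \<theta>)) * exp_weight \<theta> {x. S x}"
    using exp_weight_boundary_sum[of \<theta> "{x. S x}"] summable(1,2) finite_unlike_pairs[OF S]
    by (simp add: unlike_pairs_def current_sign_def)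
  have "(\<Sum>x\<in>unlike_pairs S. current_sign S x * exp (- \<theta> * of_int x)) =
      - (\<Sum>x\<in>unlike_pairs S. (of_bool (\<not> S x) - of_bool (\<not> S (x + 1))) * exp (- \<theta> * of_int x))"
    by (auto simp: current_sign_def simp flip: sum_negf intro!: sum.cong)
  also have "\<dots> = - ((1 - exp \<theta>) * exp_weight (- \<theta>) {x. \<not> S x})"
    using exp_weight_boundary_sum[of "- \<theta>" "{x. \<not> S x}"] summable(3,4) finite_unlike_pairs[OF S]
    by (simp add: unlike_pairs_def)
  finally show "(\<Sum>x\<in>unlike_pairs S. current_sign S x * exp (- \<theta> * of_int x)) =
      (exp \<theta> - 1) * exp_weight (- \<theta>) {x. \<not> S x}"
    by (simp add: algebra_simps)
qed

text \<open>
  An exchange changes both factors.  The two changes have the same sign, and their product does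
  not depend on the site, which gives the last summand.
\<close>
lemma spread_weight_swap_sites:
  assumes S: "S \<in> zone_configs" and "0 < \<theta>" and x: "x \<in> unlike_pairs S"
  shows "spread_weight \<theta> (swap_sites x S) = spread_weight \<theta> S +
    (exp \<theta> - 1) * exp_weight (- \<theta>) {x. \<not> S x} * (current_sign S x * exp (\<theta> * of_int x)) +
    (1 - exp (- \<theta>)) * exp_weight \<theta> {x. S x} * (current_sign S x * exp (- \<theta> * of_int x)) +
    (exp \<theta> - 1) * (1 - exp (- \<theta>))"
proof -
  note summable = summable_on_ones_zeros[OF S \<open>0 < \<theta>\<close>]
  have x': "S x \<noteq> S (x + 1)" using x by (simp add: unlike_pairs_def)
  let ?\<sigma> = "current_sign S x"
  have ones: "exp_weight \<theta> {y. swap_sites x S y} =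
      exp_weight \<theta> {x. S x} + ?\<sigma> * (exp \<theta> - 1) * exp (\<theta> * of_int x)"
    using infsum_transposed[OF summable(1), of x] x'
    by (simp add: exp_weight_def swap_sites_def current_sign_def algebra_simps exp_add)
  have zeros: "exp_weight (- \<theta>) {y. \<not> swap_sites x S y} =
      exp_weight (- \<theta>) {x. \<not> S x} + ?\<sigma> * (1 - exp (- \<theta>)) * exp (- \<theta> * of_int x)"
    using infsum_transposed[OF summable(3), of x] x'
    by (auto simp add: exp_weight_def swap_sites_def current_sign_def algebra_simps exp_diff exp_minus
        divide_inverse exp_add)
  have "?\<sigma> * ?\<sigma> = 1" using x' by (auto simp: current_sign_def)
  moreover have "exp (\<theta> * of_int x) * exp (- \<theta> * of_int x) = 1"
    by (simp flip: exp_add)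
  ultimately have "(?\<sigma> * (exp \<theta> - 1) * exp (\<theta> * of_int x)) * (?\<sigma> * (1 - exp (- \<theta>)) * exp (- \<theta> * of_int x)) =
      (exp \<theta> - 1) * (1 - exp (- \<theta>))"
    by (metis (no_types, opaque_lifting) mult.assoc mult.commute mult.right_neutral)
  then show ?thesis
    unfolding spread_weight_def ones zeros by (simp add: algebra_simps)
qed

text \<open>
  Exponentials are eigenfunctions of the discrete Laplacian, with eigenvalue
  \<open>exp \<theta> + exp (- \<theta>) - 2 = (exp \<theta> - 1) * (1 - exp (- \<theta>))\<close>: each factor contributes its
  eigenvalue, whatever the configuration, and the products of the two changes contribute it once
  for each unlike pair.
\<close>
lemma sum_spread_weight_swap_sites:
  assumes S: "S \<in> zone_configs" and "0 < \<theta>"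
  shows "(\<Sum>x\<in>unlike_pairs S. spread_weight \<theta> (swap_sites x S) - spread_weight \<theta> S) =
    (exp \<theta> - 1) * (1 - exp (- \<theta>)) * (2 * spread_weight \<theta> S + real (card (unlike_pairs S)))"
proof -
  have "(\<Sum>x\<in>unlike_pairs S. spread_weight \<theta> (swap_sites x S) - spread_weight \<theta> S) =
    (\<Sum>x\<in>unlike_pairs S.
      (exp \<theta> - 1) * exp_weight (- \<theta>) {x. \<not> S x} * (current_sign S x * exp (\<theta> * of_int x)) +
      (1 - exp (- \<theta>)) * exp_weight \<theta> {x. S x} * (current_sign S x * exp (- \<theta> * of_int x)) +
      (exp \<theta> - 1) * (1 - exp (- \<theta>)))"
    by (intro sum.cong refl) (subst spread_weight_swap_sites[OF assms], simp_all)
  also have "\<dots> = (exp \<theta> - 1) * exp_weight (- \<theta>) {x. \<not> S x} * ((1 - exp (- \<theta>)) * exp_weight \<theta> {x. S x}) +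
      (1 - exp (- \<theta>)) * exp_weight \<theta> {x. S x} * ((exp \<theta> - 1) * exp_weight (- \<theta>) {x. \<not> S x}) +
      real (card (unlike_pairs S)) * ((exp \<theta> - 1) * (1 - exp (- \<theta>)))"
    by (simp only: sum.distrib sum_distrib_left[symmetric] boundary_sums[OF assms] sum_constant)
       (simp only: ac_simps)
  also have "\<dots> = (exp \<theta> - 1) * (1 - exp (- \<theta>)) * (2 * spread_weight \<theta> S + real (card (unlike_pairs S)))"
    by (simp add: spread_weight_def algebra_simps)
  finally show ?thesis .
qed

text \<open>
  The summand of the rightmost particle and the leftmost hole.
\<close>
lemma spread_weight_ge:
  assumes S: "S \<in> zone_configs" and "0 < \<theta>"
  shows "exp (\<theta> * (real (config_size S) - 1)) \<le> spread_weight \<theta> S"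
proof -
  have "real (config_size S) = of_int (int (config_size S))" by simp
  then have size: "real (config_size S) - 1 = of_int (rightmost_one S) - of_int (leftmost_zero S)"
    unfolding config_size_eq[OF S] by simp
  have "exp (\<theta> * (real (config_size S) - 1)) =
      exp (\<theta> * of_int (rightmost_one S)) * exp (- \<theta> * of_int (leftmost_zero S))"
    unfolding size by (simp add: algebra_simps flip: exp_add)
  also have "\<dots> \<le> spread_weight \<theta> S"
    unfolding spread_weight_def
    using zone_extremes(1,3)[OF S] summable_on_ones_zeros[OF assms]
    by (intro mult_mono exp_weight_ge) (auto simp: exp_weight_nonneg)
  finally show ?thesis .
qed

text \<open>
  In both boundary sums the terms are bounded by the exponential at the outermost unlike pair, and
  \<open>1 - exp (- \<theta>) \<ge> \<theta> / (1 + \<theta>)\<close>.  It matters that the growth in \<open>1 / \<theta>\<close> is polynomial: the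
  weight of the initial configuration is later compared with a bound that decays faster than every
  power of the time.
\<close>
lemma spread_weight_le:
  assumes S: "S \<in> zone_configs" and "0 < \<theta>"
  shows "spread_weight \<theta> S \<le> (real (config_size S + 1) * (1 + 1 / \<theta>))\<^sup>2 * exp (\<theta> * real (config_size S))"
proof -
  let ?N = "real (card (unlike_pairs S))"
  have range: "leftmost_zero S - 1 \<le> x" "x \<le> rightmost_one S" if "x \<in> unlike_pairs S" for x
    using zone_extremes(2)[OF S, of x] zone_extremes(2)[OF S, of "x + 1"]
      zone_extremes(4)[OF S, of x] zone_extremes(4)[OF S, of "x + 1"] that
    by (fastforce simp: unlike_pairs_def)+
  have sign: "current_sign S x \<le> 1" for x by (simp add: current_sign_def)
  have gap: "\<theta> / (1 + \<theta>) \<le> 1 - exp (- \<theta>)"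
  proof -
    have "exp (- \<theta>) \<le> 1 / (1 + \<theta>)"
      using exp_ge_add_one_self[of \<theta>] \<open>0 < \<theta>\<close> by (simp add: exp_minus field_simps)
    then show ?thesis using \<open>0 < \<theta>\<close> by (simp add: field_simps)
  qed
  have sum_le: "w \<le> ?N * (1 + 1 / \<theta>) * u"
    if "(1 - exp (- \<theta>)) * w \<le> ?N * u" "0 \<le> w" for w u
  proof -
    have "\<theta> / (1 + \<theta>) * w \<le> ?N * u"
      using mult_right_mono[OF gap \<open>0 \<le> w\<close>] that(1) by linarith
    then show ?thesis using \<open>0 < \<theta>\<close> by (simp add: field_simps)
  qed
  have "(1 - exp (- \<theta>)) * exp_weight \<theta> {x. S x} \<le> ?N * exp (\<theta> * of_int (rightmost_one S))"
    unfolding boundary_sums(1)[OF assms, symmetric]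
  proof (rule sum_bounded_above)
    fix x assume x: "x \<in> unlike_pairs S"
    have "current_sign S x * exp (\<theta> * of_int x) \<le> 1 * exp (\<theta> * of_int x)"
      by (intro mult_right_mono sign) simp
    also have "\<dots> \<le> exp (\<theta> * of_int (rightmost_one S))"
      using range[OF x] \<open>0 < \<theta>\<close> by simp
    finally show "current_sign S x * exp (\<theta> * of_int x) \<le> exp (\<theta> * of_int (rightmost_one S))" .
  qed
  then have ones: "exp_weight \<theta> {x. S x} \<le> ?N * (1 + 1 / \<theta>) * exp (\<theta> * of_int (rightmost_one S))"
    by (rule sum_le) (rule exp_weight_nonneg)
  have "(exp \<theta> - 1) * exp_weight (- \<theta>) {x. \<not> S x} \<le> ?N * exp (\<theta> * (1 - of_int (leftmost_zero S)))"
    unfolding boundary_sums(2)[OF assms, symmetric]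
  proof (rule sum_bounded_above)
    fix x assume x: "x \<in> unlike_pairs S"
    have "current_sign S x * exp (- \<theta> * of_int x) \<le> 1 * exp (- \<theta> * of_int x)"
      by (intro mult_right_mono sign) simp
    also have "\<dots> \<le> exp (\<theta> * (1 - of_int (leftmost_zero S)))"
    proof -
      have "\<theta> * (of_int (leftmost_zero S) - 1) \<le> \<theta> * of_int x"
        using range[OF x] \<open>0 < \<theta>\<close> by (intro mult_left_mono) linarith+
      then show ?thesis by (simp add: algebra_simps)
    qed
    finally show "current_sign S x * exp (- \<theta> * of_int x) \<le> exp (\<theta> * (1 - of_int (leftmost_zero S)))" .
  qed
  then have "exp (- \<theta>) * ((exp \<theta> - 1) * exp_weight (- \<theta>) {x. \<not> S x}) \<le>
      exp (- \<theta>) * (?N * exp (\<theta> * (1 - of_int (leftmost_zero S))))"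
    by (rule mult_left_mono) simp
  moreover have "exp (- \<theta>) * ((exp \<theta> - 1) * exp_weight (- \<theta>) {x. \<not> S x}) =
      (1 - exp (- \<theta>)) * exp_weight (- \<theta>) {x. \<not> S x}"
    by (simp add: algebra_simps flip: exp_add mult.assoc)
  moreover have "exp (- \<theta>) * (?N * exp (\<theta> * (1 - of_int (leftmost_zero S)))) =
      ?N * exp (- \<theta> * of_int (leftmost_zero S))"
    by (simp add: algebra_simps flip: exp_add)
  ultimately have "(1 - exp (- \<theta>)) * exp_weight (- \<theta>) {x. \<not> S x} \<le> ?N * exp (- \<theta> * of_int (leftmost_zero S))"
    by simp
  then have zeros: "exp_weight (- \<theta>) {x. \<not> S x} \<le> ?N * (1 + 1 / \<theta>) * exp (- \<theta> * of_int (leftmost_zero S))"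
    by (rule sum_le) (rule exp_weight_nonneg)
  have "spread_weight \<theta> S \<le>
      (?N * (1 + 1 / \<theta>) * exp (\<theta> * of_int (rightmost_one S))) *
      (?N * (1 + 1 / \<theta>) * exp (- \<theta> * of_int (leftmost_zero S)))"
    unfolding spread_weight_def using \<open>0 < \<theta>\<close>
    by (intro mult_mono ones zeros) (auto simp: exp_weight_nonneg)
  also have "\<dots> = (?N * (1 + 1 / \<theta>))\<^sup>2 *
      exp (\<theta> * of_int (rightmost_one S - leftmost_zero S))"
  proof -
    have "exp (\<theta> * of_int (rightmost_one S - leftmost_zero S)) =
        exp (\<theta> * of_int (rightmost_one S)) * exp (- \<theta> * of_int (leftmost_zero S))"
      by (simp add: algebra_simps flip: exp_add)
    then show ?thesis by (simp only: power2_eq_square mult.assoc mult.commute mult.left_commute)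
  qed
  also have "\<dots> \<le> (real (config_size S + 1) * (1 + 1 / \<theta>))\<^sup>2 * exp (\<theta> * real (config_size S))"
  proof (intro mult_mono power_mono)
    show "?N \<le> real (config_size S + 1)"
      using card_unlike_pairs_le[OF S] by linarith
    have "real (config_size S) = of_int (int (config_size S))" by simp
    then have "of_int (rightmost_one S - leftmost_zero S) \<le> real (config_size S)"
      unfolding config_size_eq[OF S] by simp
    then show "exp (\<theta> * of_int (rightmost_one S - leftmost_zero S)) \<le> exp (\<theta> * real (config_size S))"
      using \<open>0 < \<theta>\<close> by simp
  qed (use \<open>0 < \<theta>\<close> in auto)
  finally show ?thesis .
qed


section \<open>Drift of the Lyapunov functions on zones\<close>

lemma countable_zone_configs: "countable zone_configs"
proof -
  \<comment> \<open>A configuration is determined by its finitely many defects off the origin and its value there.\<close>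
  define code where "code = (\<lambda>S::config. ({x. x < 0 \<and> \<not> S x}, {x. x > 0 \<and> S x}, S 0))"
  have "inj_on code zone_configs"
  proof (rule inj_onI, rule ext)
    fix S T :: config and x :: int
    assume "code S = code T"
    then have "(x < 0 \<and> \<not> S x) = (x < 0 \<and> \<not> T x)" "(x > 0 \<and> S x) = (x > 0 \<and> T x)" "S 0 = T 0"
      by (auto simp: code_def set_eq_iff)
    then show "S x = T x" by (cases "x = 0") auto
  qed
  moreover have "code ` zone_configs \<subseteq> {A. finite A} \<times> {A. finite A} \<times> UNIV"
    by (auto simp: code_def zone_configs_def)
  then have "countable (code ` zone_configs)"
    by (rule countable_subset) (intro countable_SIGMA countable_Collect_finite countableI_type)
  ultimately show ?thesis by (rule countable_image_inj_on[rotated])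
qed

lemma translates_refl: "S \<in> zone_configs \<Longrightarrow> translates S S"
  by (auto simp: translates_def translate_def intro!: exI[of _ 0])

lemma zone_cases_config:
  obtains S where "S \<in> zone_configs" "Z = abs_zone S"
proof -
  have "translates (rep_zone Z) (rep_zone Z)" "abs_zone (rep_zone Z) = Z"
    using Quotient_rep_reflp[OF Quotient_zone] Quotient_abs_rep[OF Quotient_zone] by auto
  then show ?thesis using that[of "rep_zone Z"] by (auto simp: translates_def)
qed

instance zone :: countable
proof
  have "UNIV = abs_zone ` zone_configs"
    using zone_cases_config by (metis (no_types, lifting) UNIV_eq_I image_eqI)
  then have "countable (UNIV :: zone set)"
    by (metis countable_image countable_zone_configs)
  then show "\<exists>f :: zone \<Rightarrow> nat. inj f"
    by (blast elim: countableE)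
qed

lift_definition zone_inversions :: "zone \<Rightarrow> nat" is "\<lambda>S. card (inversions S)"
proof -
  fix S T assume "translates S T"
  then obtain k where T: "T = translate k S" by (auto simp: translates_def)
  have "bij_betw (map_prod (\<lambda>u. u - k) (\<lambda>v. v - k)) (inversions S) (inversions T)"
    by (rule bij_betw_byWitness[where f' = "map_prod (\<lambda>u. u + k) (\<lambda>v. v + k)"])
       (auto simp: T inversions_def translate_def)
  then show "card (inversions S) = card (inversions T)"
    by (rule bij_betw_same_card)
qed

lift_definition zone_spread :: "real \<Rightarrow> zone \<Rightarrow> real" is spread_weight
proof -
  fix \<theta> :: real and S T assume "translates S T"
  then obtain k where T: "T = translate k S" by (auto simp: translates_def)
  have "spread_weight \<theta> T = exp (- \<theta> * of_int k) * exp (\<theta> * of_int k) * spread_weight \<theta> S"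
    using exp_weight_shift[of \<theta> k "{x. S x}"] exp_weight_shift[of "- \<theta>" k "{x. \<not> S x}"]
    by (simp add: spread_weight_def T translate_def)
  then show "spread_weight \<theta> S = spread_weight \<theta> T"
    by (simp flip: exp_add)
qed

lemma finite_set_zone_step: "finite (set_pmf (zone_step 0 (1 / 2) Z))"
proof -
  obtain S where S: "S \<in> zone_configs" "Z = abs_zone S" by (rule zone_cases_config)
  have "finite (set_pmf (config_step 0 (1 / 2) S))"
    unfolding config_step_symmetric_exclusion[OF S(1)]
    using finite_unlike_pairs[OF S(1)] unlike_pairs_nonempty[OF S(1)] by simp
  then show ?thesis
    unfolding S(2) zone_step.abs_eq[OF translates_refl[OF S(1)]] by simp
qed

lemma expectation_zone_step:
  assumes S: "S \<in> zone_configs"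
  shows "measure_pmf.expectation (zone_step 0 (1 / 2) (abs_zone S)) F - F (abs_zone S) =
    (\<Sum>x\<in>unlike_pairs S. F (abs_zone (swap_sites x S)) - F (abs_zone S)) /
      (2 * real (card (unlike_pairs S)))"
proof -
  let ?U = "unlike_pairs S" and ?f = "\<lambda>S. F (abs_zone S)"
  have U: "finite ?U" "?U \<noteq> {}" "card ?U \<noteq> 0"
    using finite_unlike_pairs[OF S] unlike_pairs_nonempty[OF S] by auto
  have "measure_pmf.expectation (zone_step 0 (1 / 2) (abs_zone S)) F =
      measure_pmf.expectation (config_step 0 (1 / 2) S) ?f"
    by (simp add: zone_step.abs_eq[OF translates_refl[OF S]])
  also have "\<dots> = (\<Sum>x\<in>?U. ((?f (swap_sites x S) + ?f S) / 2) /\<^sub>R real (card ?U))"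
    unfolding config_step_symmetric_exclusion[OF S]
    by (subst pmf_expectation_bind_pmf_of_set[OF U(2,1)]) (auto simp: field_simps)
  also have "\<dots> = (\<Sum>x\<in>?U. (?f (swap_sites x S) - ?f S) / (2 * real (card ?U)) + ?f S / real (card ?U))"
    using U by (intro sum.cong refl) (simp add: field_simps)
  also have "\<dots> = (\<Sum>x\<in>?U. ?f (swap_sites x S) - ?f S) / (2 * real (card ?U)) + ?f S"
    using U by (simp add: sum.distrib sum_divide_distrib)
  finally show ?thesis by simp
qed

text \<open>
  Pairs 10 create an inversion and pairs 01 destroy one, and there is one more of the former: so
  among \<open>N\<close> unlike pairs the mean gain is \<open>1 / (2 * N)\<close>.  The unlike pairs lie in the zone or at
  its left end.
\<close>
lemma zone_inversions_drift:
  "real (zone_inversions Z) + 1 / (2 * real (zone_size Z + 1))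
    \<le> measure_pmf.expectation (zone_step 0 (1 / 2) Z) (\<lambda>Z. real (zone_inversions Z))"
proof -
  obtain S where S: "S \<in> zone_configs" "Z = abs_zone S" by (rule zone_cases_config)
  have "measure_pmf.expectation (zone_step 0 (1 / 2) Z) (\<lambda>Z. real (zone_inversions Z)) - real (zone_inversions Z) =
     (\<Sum>x\<in>unlike_pairs S. real (card (inversions (swap_sites x S))) - real (card (inversions S))) /
      (2 * real (card (unlike_pairs S)))"
    using expectation_zone_step[OF S(1), of "\<lambda>Z. real (zone_inversions Z)"]
    by (simp add: zone_inversions.abs_eq translates_refl swap_sites_in_zone_configs S)
  also have "\<dots> = 1 / (2 * real (card (unlike_pairs S)))"
    using sum_current_sign[OF S(1)] by (simp add: card_inversions_swap_sites S)
  also have "\<dots> \<ge> 1 / (2 * real (zone_size Z + 1))"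
  proof (rule divide_left_mono)
    have "0 < card (unlike_pairs S)"
      using finite_unlike_pairs[OF S(1)] unlike_pairs_nonempty[OF S(1)] by (simp add: card_gt_0_iff)
    then show "0 < 2 * real (zone_size Z + 1) * (2 * real (card (unlike_pairs S)))"
      "2 * real (card (unlike_pairs S)) \<le> 2 * real (zone_size Z + 1)"
      using card_unlike_pairs_le[OF S(1)]
      by (auto simp: S(2) zone_size.abs_eq translates_refl S(1))
  qed simp
  finally show ?thesis by simp
qed

lemma zone_inversions_le: "zone_inversions Z \<le> (zone_size Z)\<^sup>2"
proof -
  obtain S where "S \<in> zone_configs" "Z = abs_zone S" by (rule zone_cases_config)
  then show ?thesis
    using card_inversions_le by (simp add: zone_inversions.abs_eq zone_size.abs_eq translates_refl)
qed

lemma zone_inversions_step_le: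
  assumes "Z' \<in> set_pmf (zone_step 0 (1 / 2) Z)"
  shows "zone_inversions Z' \<le> zone_inversions Z + 1"
proof -
  obtain S where S: "S \<in> zone_configs" "Z = abs_zone S" by (rule zone_cases_config)
  have "set_pmf (config_step 0 (1 / 2) S) \<subseteq> insert S ((\<lambda>x. swap_sites x S) ` unlike_pairs S)"
    unfolding config_step_symmetric_exclusion[OF S(1)]
    using finite_unlike_pairs[OF S(1)] unlike_pairs_nonempty[OF S(1)] by auto
  with assms obtain T where T: "Z' = abs_zone T" "T = S \<or> (\<exists>x\<in>unlike_pairs S. T = swap_sites x S)"
    unfolding S(2) zone_step.abs_eq[OF translates_refl[OF S(1)]] by auto
  have "real (card (inversions T)) \<le> real (card (inversions S)) + 1"
    using T(2) card_inversions_swap_sites[OF S(1)] by (auto simp: current_sign_def)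
  moreover have "T \<in> zone_configs"
    using T(2) S(1) swap_sites_in_zone_configs by auto
  ultimately show ?thesis
    using S by (simp add: T(1) zone_inversions.abs_eq translates_refl)
qed

text \<open>
  With \<open>N\<close> unlike pairs and weight \<open>w\<close>, the exact drift is the eigenvalue times \<open>w / N + 1 / 2\<close>.  Adding
  1 to the weight makes the bound multiplicative.
\<close>
lemma zone_spread_drift:
  assumes "0 < \<theta>"
  shows "measure_pmf.expectation (zone_step 0 (1 / 2) Z) (\<lambda>Z. zone_spread \<theta> Z + 1)
    \<le> (1 + (exp \<theta> - 1) * (1 - exp (- \<theta>))) * (zone_spread \<theta> Z + 1)"
proof -
  obtain S where S: "S \<in> zone_configs" "Z = abs_zone S" by (rule zone_cases_config)
  let ?N = "real (card (unlike_pairs S))" and ?c = "(exp \<theta> - 1) * (1 - exp (- \<theta>))"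
  have "card (unlike_pairs S) \<noteq> 0"
    using finite_unlike_pairs[OF S(1)] unlike_pairs_nonempty[OF S(1)] by simp
  then have N: "1 \<le> ?N" by linarith
  have w: "0 \<le> spread_weight \<theta> S" by (simp add: spread_weight_def exp_weight_nonneg)
  have "measure_pmf.expectation (zone_step 0 (1 / 2) Z) (\<lambda>Z. zone_spread \<theta> Z + 1) - (zone_spread \<theta> Z + 1) =
     (\<Sum>x\<in>unlike_pairs S. spread_weight \<theta> (swap_sites x S) - spread_weight \<theta> S) / (2 * ?N)"
    using expectation_zone_step[OF S(1), of "\<lambda>Z. zone_spread \<theta> Z + 1"]
    by (simp add: zone_spread.abs_eq translates_refl swap_sites_in_zone_configs S)
  also have "\<dots> = ?c * ((2 * spread_weight \<theta> S + ?N) / (2 * ?N))"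
    unfolding sum_spread_weight_swap_sites[OF S(1) assms] by simp
  also have "\<dots> \<le> ?c * (spread_weight \<theta> S + 1)"
  proof (rule mult_left_mono)
    have "spread_weight \<theta> S * 1 \<le> spread_weight \<theta> S * ?N"
      using w N by (intro mult_left_mono) auto
    then have "2 * spread_weight \<theta> S + ?N \<le> (spread_weight \<theta> S + 1) * (2 * ?N)"
      using N unfolding distrib_right by linarith
    then show "(2 * spread_weight \<theta> S + ?N) / (2 * ?N) \<le> spread_weight \<theta> S + 1"
      using N by (subst pos_divide_le_eq) auto
  qed (use assms in simp)
  finally show ?thesis
    by (simp add: S zone_spread.abs_eq translates_refl algebra_simps)
qed

lemma zone_spread_bounds:
  assumes "0 < \<theta>"
  shows "exp (\<theta> * (real (zone_size Z) - 1)) \<le> zone_spread \<theta> Z"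
    "zone_spread \<theta> Z \<le> (real (zone_size Z + 1) * (1 + 1 / \<theta>))\<^sup>2 * exp (\<theta> * real (zone_size Z))"
proof -
  obtain S where "S \<in> zone_configs" "Z = abs_zone S" by (rule zone_cases_config)
  then show "exp (\<theta> * (real (zone_size Z) - 1)) \<le> zone_spread \<theta> Z"
    "zone_spread \<theta> Z \<le> (real (zone_size Z + 1) * (1 + 1 / \<theta>))\<^sup>2 * exp (\<theta> * real (zone_size Z))"
    using spread_weight_ge[OF _ assms] spread_weight_le[OF _ assms]
    by (simp_all add: zone_spread.abs_eq zone_size.abs_eq translates_refl)
qed


section \<open>Probabilities of small and of large zones\<close>

text \<open>
  While the size is at most \<open>r\<close>, the number of inversions has drift at least of order \<open>1 / r\<close> and
  stays below order \<open>r\<^sup>2\<close>, so the expected time to grow beyond \<open>r\<close> is at most of order \<open>r ^ 3\<close>.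
\<close>
lemma small_zone_prob:
  assumes "0 \<le> r"
  shows "real n * confinement_prob (zone_step 0 (1 / 2)) {Z. real (zone_size Z) \<le> r} n Z \<le> 6 * (r ^ 3 + 1)"
proof -
  let ?A = "{Z. real (zone_size Z) \<le> r}"
  have inv: "real (zone_inversions Z) \<le> r\<^sup>2" if "Z \<in> ?A" for Z
  proof -
    have "real (zone_inversions Z) \<le> (real (zone_size Z))\<^sup>2"
      using zone_inversions_le[of Z] by (metis of_nat_le_iff of_nat_power)
    also have "\<dots> \<le> r\<^sup>2" using that by (intro power_mono) auto
    finally show ?thesis .
  qed
  have "real n * confinement_prob (zone_step 0 (1 / 2)) ?A n Z \<le> (r\<^sup>2 + 1) / (1 / (2 * (r + 1)))"
  proof (rule confinement_le_if_drift_bounded_below[where g = "\<lambda>Z. real (zone_inversions Z)"])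
    show "real (zone_inversions Z) + 1 / (2 * (r + 1))
        \<le> measure_pmf.expectation (zone_step 0 (1 / 2) Z) (\<lambda>Z. real (zone_inversions Z))"
      if "Z \<in> ?A" for Z
    proof -
      have "1 / (2 * (r + 1)) \<le> 1 / (2 * real (zone_size Z + 1))"
        using that by (intro divide_left_mono) (auto simp: add_nonneg_pos)
      then show ?thesis using zone_inversions_drift[of Z] by linarith
    qed
    show "real (zone_inversions Z) \<le> r\<^sup>2 + 1" if "Z \<in> ?A" for Z
      using inv[OF that] by simp
    show "real (zone_inversions Z') \<le> r\<^sup>2 + 1"
      if "Z \<in> ?A" "Z' \<in> set_pmf (zone_step 0 (1 / 2) Z)" for Z Z'
      using inv[OF that(1)] zone_inversions_step_le[OF that(2)] by linarith
  qed (use assms finite_set_zone_step in auto)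
  also have "\<dots> = 2 * (r ^ 3 + r\<^sup>2 + r + 1)"
    using assms by (simp add: field_simps power3_eq_cube power2_eq_square)
  also have "\<dots> \<le> 6 * (r ^ 3 + 1)"
  proof -
    have "r\<^sup>2 \<le> r ^ 3 + 1 \<and> r \<le> r ^ 3 + 1"
    proof (cases "1 \<le> r")
      case True
      then have "r \<le> r ^ 3" "r\<^sup>2 \<le> r ^ 3" by (auto intro: self_le_power power_increasing)
      then show ?thesis by simp
    next
      case False
      then have "r\<^sup>2 \<le> 1" "r \<le> 1" "0 \<le> r ^ 3" using assms by (auto intro: power_le_one)
      then show ?thesis by linarith
    qed
    then have "r\<^sup>2 \<le> r ^ 3 + 1" "r \<le> r ^ 3 + 1" by auto
    then show ?thesis unfolding distrib_left by linarith
  qed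
  finally show ?thesis .
qed

text \<open>
  The maximal inequality for the spread weight plus 1, normalised to be at least 1 when the size
  exceeds \<open>r\<close>.  Its mean grows per step by a factor that exceeds 1 only to second order in \<open>\<theta>\<close>,
  as for a simple random walk.
\<close>
lemma large_zone_prob:
  assumes "0 < \<theta>" "\<theta> \<le> 1"
  shows "1 - confinement_prob (zone_step 0 (1 / 2)) {Z. real (zone_size Z) \<le> r} n Z
    \<le> exp (2 * \<theta>\<^sup>2 * real n) * ((zone_spread \<theta> Z + 1) * exp (\<theta> * (1 - r)))"
proof -
  let ?c = "1 + (exp \<theta> - 1) * (1 - exp (- \<theta>))"
  let ?g = "\<lambda>Z. (zone_spread \<theta> Z + 1) * exp (\<theta> * (1 - r))"
  have spread: "exp (\<theta> * (real (zone_size Z) - 1)) \<le> zone_spread \<theta> Z" "0 \<le> zone_spread \<theta> Z" for Z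
  proof -
    show *: "exp (\<theta> * (real (zone_size Z) - 1)) \<le> zone_spread \<theta> Z"
      by (rule zone_spread_bounds(1)[OF assms(1)])
    show "0 \<le> zone_spread \<theta> Z"
      by (rule order_trans[OF _ *]) simp
  qed
  have "exp \<theta> \<le> 1 + \<theta> + \<theta>\<^sup>2"
    using assms by (intro exp_bound) auto
  moreover have "\<theta>\<^sup>2 \<le> \<theta>"
    using assms by (simp add: power2_eq_square mult_left_le)
  ultimately have "exp \<theta> - 1 \<le> 2 * \<theta>" by linarith
  moreover have "1 - exp (- \<theta>) \<le> \<theta>"
    using exp_ge_add_one_self[of "- \<theta>"] by linarith
  ultimately have "(exp \<theta> - 1) * (1 - exp (- \<theta>)) \<le> (2 * \<theta>) * \<theta>"
    using assms by (intro mult_mono) auto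
  then have "?c \<le> 1 + 2 * \<theta>\<^sup>2" by (simp add: power2_eq_square)
  also have "\<dots> \<le> exp (2 * \<theta>\<^sup>2)" by (rule exp_ge_add_one_self)
  finally have c: "?c \<le> exp (2 * \<theta>\<^sup>2)" .
  have "1 - confinement_prob (zone_step 0 (1 / 2)) {Z. real (zone_size Z) \<le> r} n Z \<le> ?c ^ n * ?g Z"
  proof (rule escape_le_if_expectation_grows_slowly)
    show "0 \<le> ?g Z" for Z using spread(2)[of Z] by simp
    show "1 \<le> ?g Z" if "Z \<notin> {Z. real (zone_size Z) \<le> r}" for Z
    proof -
      have "1 \<le> exp (\<theta> * (real (zone_size Z) - 1)) * exp (\<theta> * (1 - r))"
        using that assms by (simp flip: exp_add distrib_left)
      also have "\<dots> \<le> ?g Z"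
        using spread(1)[of Z] by (intro mult_right_mono) auto
      finally show ?thesis .
    qed
    show "measure_pmf.expectation (zone_step 0 (1 / 2) Z) ?g \<le> ?c * ?g Z" for Z
      using mult_right_mono[OF zone_spread_drift[OF assms(1), of Z], of "exp (\<theta> * (1 - r))"]
      by (simp add: mult.assoc)
    show "1 \<le> ?c" using assms by simp
  qed (rule finite_set_zone_step)
  also have "\<dots> \<le> exp (2 * \<theta>\<^sup>2) ^ n * ?g Z"
    using c assms spread(2)[of Z] by (intro mult_right_mono power_mono) auto
  also have "exp (2 * \<theta>\<^sup>2) ^ n = exp (2 * \<theta>\<^sup>2 * real n)"
    by (simp add: exp_of_nat_mult mult.commute)
  finally show ?thesis .
qed


section \<open>Almost sure growth\<close>

text \<open>
  The logarithm to a power above 1 outgrows every multiple of the logarithm, so the last factor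
  decays faster than any power of \<open>t\<close>.
\<close>
lemma summable_upper_bound:
  fixes \<epsilon> K :: real
  assumes "0 < \<epsilon>" "0 < K"
  shows "summable (\<lambda>t::nat. real t ^ 2 * (K * (1 + real t) ^ 2 + 1) * exp 1 * exp (- (ln (real t) powr (1 + \<epsilon>))))"
proof (rule summable_comparison_test_bigo)
  show "summable (\<lambda>t::nat. norm (real t powr (-2)))"
    by (simp add: summable_real_powr_iff)
  show "(\<lambda>t::nat. real t ^ 2 * (K * (1 + real t) ^ 2 + 1) * exp 1 * exp (- (ln (real t) powr (1 + \<epsilon>)))) \<in> O(\<lambda>t. real t powr (-2))"
    using assms by real_asymp
qed

lemma summable_lower_bound:
  fixes \<epsilon> :: real
  assumes "0 < \<epsilon>"
  shows "summable (\<lambda>j::nat. 12 * (real j * ln 2) powr (- 1 - 3 * \<epsilon>) + 6 * (1 / 2) ^ j)"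
proof -
  have "summable (\<lambda>j::nat. ln 2 powr (- 1 - 3 * \<epsilon>) * real j powr (- 1 - 3 * \<epsilon>))"
    using assms by (intro summable_mult) (simp add: summable_real_powr_iff)
  then have "summable (\<lambda>j::nat. (real j * ln 2) powr (- 1 - 3 * \<epsilon>))"
    by (simp add: powr_mult mult.commute)
  then show ?thesis
    by (intro summable_add summable_mult summable_geometric) auto
qed

text \<open>
  Borel-Cantelli along the times \<open>2 ^ j\<close>.  The threshold \<open>r j\<close> at time \<open>2 ^ j\<close> dominates the
  claimed lower bound at all times up to \<open>2 ^ Suc j\<close>, and the running maximum is monotone.
\<close>
lemma eventually_size_ge:
  fixes \<xi> :: "nat \<Rightarrow> 'w \<Rightarrow> zone"
  assumes proc: "exclusion_voter_process 0 (1 / 2) M S\<^sub>0 \<xi>" and "\<epsilon> > 0"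
  shows "AE \<omega> in M. \<forall>\<^sub>F t in sequentially. \<exists>s\<le>t.
    real t powr (1 / 3) * ln (real t) powr (- (1 / 3) - \<epsilon>) \<le> real (zone_size (\<xi> s \<omega>))"
proof -
  have chain: "markov_chain M (zone_step 0 (1 / 2)) S\<^sub>0 \<xi>"
    using proc by (simp add: exclusion_voter_process_def)
  then interpret prob_space M by (simp add: markov_chain_def)
  have [measurable]: "\<xi> i \<in> measurable M (count_space UNIV)" for i
    using chain by (simp add: markov_chain_def)
  \<comment> \<open>The power of 2 is taken at \<open>Suc j\<close> and the logarithm at \<open>j\<close>: increasing and decreasing factors
  are evaluated at opposite ends of the dyadic block.\<close>
  define r where "r j = 2 powr (real (Suc j) / 3) * (real j * ln 2) powr (- (1 / 3) - \<epsilon>)" for j :: nat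
  define E where "E j = {\<omega> \<in> space M. \<forall>i\<le>2 ^ j. \<xi> i \<omega> \<in> {Z. real (zone_size Z) \<le> r j}}" for j :: nat
  have "measure M (E j) \<le> 12 * (real j * ln 2) powr (- 1 - 3 * \<epsilon>) + 6 * (1 / 2) ^ j" for j
  proof -
    have "r j ^ 3 = 2 ^ Suc j * (real j * ln 2) powr (- 1 - 3 * \<epsilon>)"
    proof -
      have "(2 powr (real (Suc j) / 3)) ^ 3 = (2 :: real) ^ Suc j"
        by (subst powr_power) (simp_all add: powr_realpow del: of_nat_Suc power_Suc)
      moreover have "((real j * ln 2) powr (- (1 / 3) - \<epsilon>)) ^ 3 = (real j * ln 2) powr (- 1 - 3 * \<epsilon>)"
      proof (cases "j = 0")
        case False
        have "real 3 * (- (1 / 3) - \<epsilon>) = - 1 - 3 * \<epsilon>" by simp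
        then show ?thesis using False by (subst powr_power) simp_all
      qed simp
      ultimately show ?thesis by (simp only: r_def power_mult_distrib)
    qed
    moreover have "real (2 ^ j) * measure M (E j) \<le> 6 * (r j ^ 3 + 1)"
      unfolding E_def markov_chain_confined[OF chain]
      by (rule small_zone_prob) (simp add: r_def)
    ultimately show ?thesis
      by (simp add: field_simps power_divide)
  qed
  then have "summable (\<lambda>j. measure M (E j))"
    by (intro summable_comparison_test'[OF summable_lower_bound[OF \<open>0 < \<epsilon>\<close>]]) simp
  then have "AE \<omega> in M. \<forall>\<^sub>F j in sequentially. \<omega> \<in> space M - E j"
    by (intro borel_cantelli_AE1) (auto simp: E_def emeasure_eq_measure)
  then show ?thesis
  proof eventually_elim
    case (elim \<omega>)
    then obtain j\<^sub>0 where j\<^sub>0: "\<And>j. j\<^sub>0 \<le> j \<Longrightarrow> \<omega> \<in> space M - E j"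
      by (auto simp: eventually_sequentially)
    show ?case
    proof (rule eventually_sequentiallyI)
      fix t :: nat assume t: "2 ^ Suc j\<^sub>0 \<le> t"
      then have "1 \<le> t" using one_le_power[of "2 :: nat" "Suc j\<^sub>0"] by linarith
      then obtain j where j: "2 ^ j \<le> t" "t < 2 ^ (j + 1)"
        using ex_power_ivl1[of 2 t] by auto
      have "(2 :: nat) ^ Suc j\<^sub>0 < 2 ^ Suc j"
        using le_less_trans[OF t j(2)] by (simp only: Suc_eq_plus1)
      then have "Suc j\<^sub>0 < Suc j" by (rule power_less_imp_less_exp[rotated]) simp
      then have "j\<^sub>0 < j" by simp
      then have pos: "0 < real j * ln 2" by simp
      have low: "real j * ln 2 \<le> ln (real t)"
      proof -
        have "real j * ln 2 = ln (2 ^ j)" by (simp add: ln_realpow)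
        also have "\<dots> \<le> ln (real t)"
          using j(1) \<open>1 \<le> t\<close> by (subst ln_le_cancel_iff) (auto simp flip: of_nat_le_iff)
        finally show ?thesis .
      qed
      have "real t powr (1 / 3) \<le> 2 powr (real (Suc j) / 3)"
      proof -
        have "real t \<le> 2 powr real (Suc j)"
          using of_nat_mono[OF less_imp_le[OF j(2)], where 'a = real]
          by (simp add: powr_realpow del: of_nat_Suc)
        then have "real t powr (1 / 3) \<le> (2 powr real (Suc j)) powr (1 / 3)"
          by (intro powr_mono2) auto
        then show ?thesis by (simp add: powr_powr del: of_nat_Suc)
      qed
      moreover have "ln (real t) powr (- (1 / 3) - \<epsilon>) \<le> (real j * ln 2) powr (- (1 / 3) - \<epsilon>)"
        using pos low \<open>0 < \<epsilon>\<close> by (intro powr_mono2') auto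
      ultimately have le: "real t powr (1 / 3) * ln (real t) powr (- (1 / 3) - \<epsilon>) \<le> r j"
        unfolding r_def by (intro mult_mono) auto
      obtain s where "s \<le> 2 ^ j" "r j < real (zone_size (\<xi> s \<omega>))"
        using j\<^sub>0[of j] \<open>j\<^sub>0 < j\<close> by (auto simp: E_def not_le)
      with le j(1) show "\<exists>s\<le>t. real t powr (1 / 3) * ln (real t) powr (- (1 / 3) - \<epsilon>)
          \<le> real (zone_size (\<xi> s \<omega>))"
        by (intro exI[of _ s]) auto
    qed
  qed
qed

text \<open>
  The escape probabilities are already summable over all times \<open>t\<close>, so Borel-Cantelli applies to
  every time with its own threshold and its own \<open>\<theta>\<close>.
\<close>
lemma eventually_size_le:
  fixes \<xi> :: "nat \<Rightarrow> 'w \<Rightarrow> zone"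
  assumes proc: "exclusion_voter_process 0 (1 / 2) M S\<^sub>0 \<xi>" and "\<epsilon> > 0"
  shows "AE \<omega> in M. \<forall>\<^sub>F t in sequentially. \<forall>s\<le>t.
    real (zone_size (\<xi> s \<omega>)) \<le> real t powr (1 / 2) * ln (real t) powr (1 / 2 + \<epsilon>)"
proof -
  have chain: "markov_chain M (zone_step 0 (1 / 2)) S\<^sub>0 \<xi>"
    using proc by (simp add: exclusion_voter_process_def)
  then interpret prob_space M by (simp add: markov_chain_def)
  have [measurable]: "\<xi> i \<in> measurable M (count_space UNIV)" for i
    using chain by (simp add: markov_chain_def)
  define r where "r t = real t powr (1 / 2) * ln (real t) powr (1 / 2 + \<epsilon>)" for t :: nat
  define G where "G t = {\<omega> \<in> space M. \<forall>i\<le>t. \<xi> i \<omega> \<in> {Z. real (zone_size Z) \<le> r t}}" for t :: nat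
  have [measurable]: "G t \<in> sets M" for t by (simp add: G_def)
  let ?n = "real (zone_size S\<^sub>0)"
  define K where "K = (?n + 1)\<^sup>2 * exp ?n"
  have bound: "measure M (space M - G t) \<le>
      real t ^ 2 * (K * (1 + real t) ^ 2 + 1) * exp 1 * exp (- (ln (real t) powr (1 + \<epsilon>)))"
    if t: "2 \<le> t" for t
  proof -
    \<comment> \<open>The largest order of \<open>\<theta>\<close> for which the growth factor \<open>exp (2 * \<theta>\<^sup>2 * t)\<close> is still a power of
    \<open>t\<close>; then \<open>\<theta> * r t\<close> exceeds every multiple of \<open>ln t\<close>.\<close>
    define \<theta> where "\<theta> = sqrt (ln (real t) / real t)"
    have ln: "1 / 2 \<le> ln (real t)"
    proof -
      have "1 / 2 \<le> ln (2 :: real)" using ln2_ge_two_thirds by simp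
      also have "\<dots> \<le> ln (real t)" using t by simp
      finally show ?thesis .
    qed
    have \<theta>2: "\<theta>\<^sup>2 = ln (real t) / real t" using ln by (simp add: \<theta>_def)
    have "0 < \<theta>" using ln t by (simp add: \<theta>_def)
    have "ln (real t) \<le> real t" using t ln_le_minus_one[of "real t"] by linarith
    then have "\<theta> \<le> 1" using t by (simp add: \<theta>_def)
    have "1 / real t \<le> \<theta>"
    proof (rule power2_le_imp_le)
      show "(1 / real t)\<^sup>2 \<le> \<theta>\<^sup>2"
      proof -
        have "1 \<le> real t * ln (real t)"
          using mult_mono[of 2 "real t" "1 / 2" "ln (real t)"] t ln by simp
        then show ?thesis using t unfolding \<theta>2 by (simp add: power2_eq_square field_simps)
      qed
    qed (use \<open>0 < \<theta>\<close> in simp)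
    then have inv: "1 / \<theta> \<le> real t" using \<open>0 < \<theta>\<close> t by (simp add: field_simps)
    have \<theta>r: "\<theta> * r t = ln (real t) powr (1 + \<epsilon>)"
    proof -
      have "\<theta> * r t = (ln (real t) powr (1 / 2) * ln (real t) powr (1 / 2 + \<epsilon>)) *
          (real t powr (1 / 2) / real t powr (1 / 2))"
        using t ln by (simp add: \<theta>_def r_def powr_half_sqrt real_sqrt_divide)
      also have "\<dots> = ln (real t) powr (1 + \<epsilon>)"
        using t by (simp flip: powr_add)
      finally show ?thesis .
    qed
    have "zone_spread \<theta> S\<^sub>0 \<le> (real (zone_size S\<^sub>0 + 1) * (1 + 1 / \<theta>))\<^sup>2 * exp (\<theta> * ?n)"
      by (rule zone_spread_bounds(2)[OF \<open>0 < \<theta>\<close>])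
    also have "\<dots> \<le> (real (zone_size S\<^sub>0 + 1) * (1 + real t))\<^sup>2 * exp ?n"
    proof (intro mult_mono power_mono)
      show "exp (\<theta> * ?n) \<le> exp ?n"
        using mult_right_mono[OF \<open>\<theta> \<le> 1\<close>, of ?n] by simp
    qed (use inv \<open>0 < \<theta>\<close> in auto)
    also have "\<dots> = K * (1 + real t)\<^sup>2"
      by (simp add: K_def power_mult_distrib mult.assoc mult.commute mult.left_commute add.commute)
    finally have spread: "zone_spread \<theta> S\<^sub>0 + 1 \<le> K * (1 + real t)\<^sup>2 + 1" by simp
    have "measure M (space M - G t) = 1 - measure M (G t)"
      by (rule prob_compl) simp
    also have "\<dots> = 1 - confinement_prob (zone_step 0 (1 / 2)) {Z. real (zone_size Z) \<le> r t} t S\<^sub>0"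
      by (simp only: G_def markov_chain_confined[OF chain])
    also have "\<dots> \<le> exp (2 * \<theta>\<^sup>2 * real t) * ((zone_spread \<theta> S\<^sub>0 + 1) * exp (\<theta> * (1 - r t)))"
      by (rule large_zone_prob[OF \<open>0 < \<theta>\<close> \<open>\<theta> \<le> 1\<close>])
    also have "\<dots> \<le> real t ^ 2 * ((K * (1 + real t)\<^sup>2 + 1) * (exp 1 * exp (- (ln (real t) powr (1 + \<epsilon>)))))"
    proof (intro mult_mono spread)
      have "exp (2 * \<theta>\<^sup>2 * real t) = exp (real 2 * ln (real t))" using t by (simp add: \<theta>2)
      also have "\<dots> = real t ^ 2" using t by (subst exp_of_nat_mult) simp
      finally show "exp (2 * \<theta>\<^sup>2 * real t) \<le> real t ^ 2" by simp
      show "exp (\<theta> * (1 - r t)) \<le> exp 1 * exp (- (ln (real t) powr (1 + \<epsilon>)))"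
        using \<open>\<theta> \<le> 1\<close> \<theta>r by (simp add: algebra_simps flip: exp_add)
      show "0 \<le> K * (1 + real t)\<^sup>2 + 1" by (simp add: K_def)
      show "0 \<le> (zone_spread \<theta> S\<^sub>0 + 1) * exp (\<theta> * (1 - r t))"
        using order_trans[OF exp_ge_zero zone_spread_bounds(1)[OF \<open>0 < \<theta>\<close>, of S\<^sub>0]] by simp
    qed auto
    finally show ?thesis by (simp only: mult.assoc)
  qed
  have "0 < K" by (simp add: K_def add_nonneg_pos)
  have "summable (\<lambda>t. measure M (space M - G t))"
    by (rule summable_comparison_test'[OF summable_upper_bound[OF \<open>0 < \<epsilon>\<close> \<open>0 < K\<close>], of 2])
       (use bound in auto)
  then have "AE \<omega> in M. \<forall>\<^sub>F t in sequentially. \<omega> \<in> space M - (space M - G t)"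
    by (intro borel_cantelli_AE1) (auto simp: emeasure_eq_measure)
  then show ?thesis
    by eventually_elim (auto simp: G_def r_def elim!: eventually_mono)
qed

theorem theorem9:
  fixes M :: "'w measure" and \<xi> :: "nat \<Rightarrow> 'w \<Rightarrow> zone" and S\<^sub>0 :: zone and \<epsilon> :: real
  assumes "exclusion_voter_process 0 (1 / 2) M S\<^sub>0 \<xi>"
    and "\<epsilon> > 0"
  shows "AE \<omega> in M. \<forall>\<^sub>F t in sequentially.
      real t powr (1 / 3) * ln (real t) powr (- (1 / 3) - \<epsilon>)
        \<le> real (Max ((\<lambda>s. zone_size (\<xi> s \<omega>)) ` {0..t})) \<and>
      real (Max ((\<lambda>s. zone_size (\<xi> s \<omega>)) ` {0..t}))
        \<le> real t powr (1 / 2) * ln (real t) powr (1 / 2 + \<epsilon>)"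
  using eventually_size_ge[OF assms] eventually_size_le[OF assms]
proof eventually_elim
  case (elim \<omega>)
  then show ?case
  proof eventually_elim
    case (elim t)
    let ?m = "Max ((\<lambda>s. zone_size (\<xi> s \<omega>)) ` {0..t})"
    have "?m \<in> (\<lambda>s. zone_size (\<xi> s \<omega>)) ` {0..t}"
      by (rule Max_in) auto
    moreover have "zone_size (\<xi> s \<omega>) \<le> ?m" if "s \<le> t" for s
      using that by (intro Max_ge) auto
    ultimately show ?case
      using elim by (force intro: order_trans)
  qed
qed

end
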